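(* Let $\boldsymbol{a}\in\mathbb{Z}^3\setminus\{\boldsymbol{0}\}$, and let $\theta\in(0,\pi)$, $\theta\neq\pi/2$. Let $N$ denote the square-free part of the positive integer $\|\boldsymbol{a}\|^2$. (1) If $\tan^2\theta$ is the square of a rational number, then $\theta\in\Theta_3(\boldsymbol{a})$ if and only if $N$ is of the form $2^b q_1\cdots q_t$ with $q_j\equiv 1\pmod 4$ for all $j$. (2) If the square-free part of $\tan^2\theta$ is $2$ (i.e. $\tan^2\theta=2x^2$ for some nonzero rational $x$), then $\theta\in\Theta_3(\boldsymbol{a})$ if and only if $N$ is of the form $2^b q_1\cdots q_t$ with $q_j\equiv 1$ or $3\pmod 8$ for all $j$. (3) Suppose the square-free part of $\tan^2\theta$ is an odd prime $p$ (i.e. $\tan^2\theta=px^2$ for some nonzero rational $x$). (a) If $p\equiv 3\pmod 8$, then $\theta\in\Theta_3(\boldsymbol{a})$ if and only if $N$ is of the form $2p^{b}q_1\cdots q_t$ with $\left(\frac{q_j}{p}\right)=1$ for $j=1,\ldots,t$. (b) If $p\equiv 1\pmod 8$, then $\theta\in\Theta_3(\boldsymbol{a})$ if and only if $N$ is of the form $2^b p^{b'}q_1\cdots q_t$ with $\left(\frac{q_j}{p}\right)=(-1)^{(q_j-1)/2}$ for $j=1,\ldots,t$ and $(q_1\cdots q_t-1)/2$ even. (c) If $p\equiv 5\pmod 8$, then $\theta\in\Theta_3(\boldsymbol{a})$ if and only if either $N$ is of the form $p^{b}q_1\cdots q_t$ with $\left(\frac{q_j}{p}\right)=(-1)^{(q_j-1)/2}$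 for $j=1,\ldots,t$ and $(q_1\cdots q_t-1)/2$ even, or $N$ is of the form $2p^{b}q_1\cdots q_t$ with $\left(\frac{q_j}{p}\right)=(-1)^{(q_j-1)/2}$ for $j=1,\ldots,t$ and $(q_1\cdots q_t-1)/2$ odd. Here, in each "of the form" condition, $b,b'\in\{0,1\}$, $t\ge 0$, and $q_1,\ldots,q_t$ are odd primes, with $q_1\cdots q_t=1$ when $t=0$.
   Context: For nonzero $\boldsymbol{a},\boldsymbol{b}\in\mathbb{R}^3$, $\angle(\boldsymbol{a},\boldsymbol{b}):=\arccos\dfrac{\boldsymbol{a}\cdot\boldsymbol{b}}{\|\boldsymbol{a}\|\,\|\boldsymbol{b}\|}\in[0,\pi]$, with the standard scalar product and Euclidean norm. For $\boldsymbol{a}\in\mathbb{Z}^3\setminus\{\boldsymbol{0}\}$, $\Theta_3(\boldsymbol{a}):=\{\angle(\boldsymbol{a},\boldsymbol{b})\mid \boldsymbol{b}\in\mathbb{Z}^3\setminus\{\boldsymbol{0}\}\}$. The square-free part of a positive rational number $X$ is the minimum positive integer $N$ such that $X/N$ is the square of a rational number. $\left(\frac{\cdot}{p}\right)$ is the Legendre symbol. *)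

theory Defs
  imports "HOL-Analysis.Analysis" "HOL-Number_Theory.Number_Theory"
begin

definition Z3 :: "(real ^ 3) set" where
  "Z3 = {v. \<forall>i. v $ i \<in> \<int>}"

definition vec_angle :: "real ^ 3 \<Rightarrow> real ^ 3 \<Rightarrow> real" where
  "vec_angle a b = arccos (inner a b / (norm a * norm b))"

definition Theta3 :: "real ^ 3 \<Rightarrow> real set" where
  "Theta3 a = {vec_angle a b | b. b \<in> Z3 - {0}}"

(* Unlike the library's squarefree_part, which lives on factorial semirings, this one is
   for positive rationals, given as reals so that it applies directly to norms and tangents.
   For other arguments the value is meaningless (for irrational X no such N exists), so
   uses of sqfree_part X have to ensure that X is a positive rational. *)
definition sqfree_part :: "real \<Rightarrow> nat" where
  "sqfree_part X = (LEAST N. N > 0 \<and> (\<exists>r\<in>\<rat>. X / real N = r\<^sup>2))"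

end

theory Submission
  imports Defs "HOL-Computational_Algebra.Squarefree"
begin

text \<open>
  Write \<open>tan\<^sup>2 \<theta> = t r\<^sup>2\<close> with \<open>r\<close> rational. Decomposing \<open>b\<close> along \<open>a\<close> shows that
  \<open>\<theta> \<in> \<Theta>\<^sub>3(a)\<close> iff some rational vector \<open>c\<close> of squared length \<open>t\<close> is orthogonal to \<open>a\<close>
  (take \<open>c\<close> proportional to \<open>a \<times> b\<close>; conversely \<open>b\<close> is proportional to \<open>a + r (a \<times> c)\<close>).
  Since rational reflections act transitively on rational vectors of a given length, \<open>c\<close> may be
  replaced by any fixed vector of squared length \<open>t\<close>. With \<open>c = (x, y, 0)\<close> for
  \<open>t = x\<^sup>2 + y\<^sup>2\<close> the condition becomes that \<open>N\<close> is of the form \<open>u\<^sup>2 + t v\<^sup>2\<close> over the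
  rationals; with \<open>c = (x, y, y)\<close> for a prime \<open>t = x\<^sup>2 + 2 y\<^sup>2\<close> congruent to 3 modulo 8 it becomes
  the same for \<open>2 N\<close>. Legendre's theorem on ternary forms turns this into conditions on quadratic
  residues, which quadratic reciprocity puts into the stated shape.
\<close>

section \<open>Quadratic residues\<close>

lemma squarefree_mult_imp_coprime:
  fixes a b :: "'a :: factorial_semiring_gcd"
  assumes "squarefree (a * b)"
  shows "coprime a b"
proof (rule coprimeI)
  fix c assume "c dvd a" "c dvd b"
  then have "c\<^sup>2 dvd a * b" by (simp add: power2_eq_square mult_dvd_mono)
  then show "is_unit c" using assms squarefreeD by blast
qed

text \<open>The Chinese remainder theorem glues a square root modulo \<open>m\<close> and one modulo
  \<open>n\<close> into a single root \<open>z\<close>.\<close>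

lemma QuadRes_coprime_mult:
  assumes "QuadRes m a" "QuadRes n a" "coprime m n"
  shows "QuadRes (m * n) a"
proof -
  obtain x y where xy: "[x\<^sup>2 = a] (mod m)" "[y\<^sup>2 = a] (mod n)"
    using assms by (auto simp: QuadRes_def)
  obtain z where z: "[z = x] (mod m)" "[z = y] (mod n)"
    using binary_chinese_remainder_int[OF assms(3)] by blast
  have "[z\<^sup>2 = a] (mod m)" "[z\<^sup>2 = a] (mod n)"
    using cong_trans[OF cong_pow[OF z(1)] xy(1)] cong_trans[OF cong_pow[OF z(2)] xy(2)] by auto
  then show ?thesis
    using assms(3) coprime_cong_mult[of "z\<^sup>2" a m n] unfolding QuadRes_def by blast
qed

lemma QuadRes_dvd: "QuadRes m a \<Longrightarrow> k dvd m \<Longrightarrow> QuadRes k a"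
  unfolding QuadRes_def using cong_dvd_modulus by blast

text \<open>Induction on \<open>m\<close>, splitting off one prime at a time: squarefreeness makes
  it coprime to the cofactor, so the two roots can be glued.\<close>

lemma QuadRes_squarefree_iff:
  fixes m :: nat
  assumes "squarefree m"
  shows "QuadRes (int m) a \<longleftrightarrow> (\<forall>q. prime q \<longrightarrow> q dvd m \<longrightarrow> QuadRes (int q) a)"
proof
  assume "QuadRes (int m) a"
  then show "\<forall>q. prime q \<longrightarrow> q dvd m \<longrightarrow> QuadRes (int q) a"
    by (auto intro: QuadRes_dvd)
next
  assume "\<forall>q. prime q \<longrightarrow> q dvd m \<longrightarrow> QuadRes (int q) a"
  with assms show "QuadRes (int m) a"
  proof (induction m rule: less_induct)
    case (less m)
    show ?case
    proof (cases "m = 1")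
      case True
      then show ?thesis by (auto simp: QuadRes_def)
    next
      case False
      then obtain q where q: "prime q" "q dvd m"
        using prime_factor_nat by blast
      then obtain k where k: "m = q * k" by blast
      have k0: "k > 0" using less.prems(1) k by (intro gr0I) simp
      have cop: "coprime q k" and sqk: "squarefree k"
        using less.prems(1) k squarefree_mult_imp_coprime squarefree_multD by blast+
      have "k < m" using k k0 prime_gt_1_nat[OF q(1)] by simp
      then have "QuadRes (int k) a" using less.IH[of k] sqk less.prems(2) k by auto
      moreover have "QuadRes (int q) a" using less.prems(2) q by auto
      ultimately show ?thesis using QuadRes_coprime_mult[of "int q" a "int k"] cop k by simp
    qed
  qed
qed

lemma QuadRes_1: "QuadRes 1 a"
  unfolding QuadRes_def by simp

text \<open>Every residue modulo 2 is its own square, so the prime 2 imposes no condition in the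
  criteria for the norm form.\<close>

lemma QuadRes_2: "QuadRes 2 a"
proof (cases "even a")
  case True
  then show ?thesis unfolding QuadRes_def by (intro exI[of _ 0]) (simp add: cong_def mod_eq_0_iff_dvd)
next
  case False
  then show ?thesis unfolding QuadRes_def by (intro exI[of _ 1]) (auto simp: cong_def odd_iff_mod_2_eq_one)
qed

section \<open>The Legendre symbol and its supplementary laws\<close>

lemma Legendre_eq_1_iff: "Legendre a p = 1 \<longleftrightarrow> \<not> p dvd a \<and> QuadRes p a"
  by (auto simp: Legendre_def cong_0_iff)

lemma Legendre_values: "Legendre a p \<in> {-1, 0, 1}"
  by (auto simp: Legendre_def)

text \<open>Two numbers in \<open>{-1, 0, 1}\<close> differ by at most 2, hence a congruence between
  them modulo \<open>p > 2\<close> is an equality. Identities of symbols can thus be read off from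
  Euler's criterion.\<close>

lemma Legendre_unique:
  assumes "p > 2" "[Legendre a p = k] (mod p)" "k \<in> {-1, 0, 1}"
  shows "Legendre a p = k"
proof -
  have "p dvd (Legendre a p - k)" using assms cong_iff_dvd_diff by blast
  moreover have "\<bar>Legendre a p - k\<bar> \<le> 2" using Legendre_values[of a p] assms(3) by auto
  ultimately show ?thesis using assms(1) zdvd_imp_le[of p "\<bar>Legendre a p - k\<bar>"] by fastforce
qed

lemma Legendre_mult:
  fixes p :: nat
  assumes "prime p" "2 < p"
  shows "Legendre (a * b) p = Legendre a p * Legendre b p"
proof (rule Legendre_unique)
  have "[Legendre (a * b) p = (a * b) ^ ((p - 1) div 2)] (mod p)"
    using euler_criterion assms by blast
  moreover have "[Legendre a p * Legendre b p = (a * b) ^ ((p - 1) div 2)] (mod p)"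
    unfolding power_mult_distrib using euler_criterion assms cong_mult by blast
  ultimately show "[Legendre (a * b) p = Legendre a p * Legendre b p] (mod p)"
    using cong_sym cong_trans by blast
  show "Legendre a p * Legendre b p \<in> {-1, 0, 1}"
    using Legendre_values[of a p] Legendre_values[of b p] by auto
qed (use assms in auto)

lemma Legendre_minus_1:
  fixes p :: nat
  assumes "prime p" "2 < p"
  shows "Legendre (-1) p = (-1) ^ ((p - 1) div 2)"
proof (rule Legendre_unique)
  show "(- 1) ^ ((p - 1) div 2) \<in> {- 1, 0, 1 :: int}"
    by (cases "even ((p - 1) div 2)") auto
qed (use assms euler_criterion in auto)

text \<open>Gauss's lemma with multiplier 2: the exponent counts the doubles \<open>2 x\<close>,
  \<open>1 \<le> x \<le> (p - 1) / 2\<close>, that exceed \<open>(p - 1) / 2\<close>.\<close>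

lemma Legendre_2:
  fixes p :: nat
  assumes "prime p" "2 < p"
  shows "Legendre 2 p = (-1) ^ ((p - 1) div 2 - (p - 1) div 4)"
proof -
  have odd: "odd p" using assms prime_odd_nat by blast
  have "\<not> int p dvd 2" using assms zdvd_imp_le[of "int p" 2] by auto
  then interpret GAUSS p 2
    using assms by unfold_locales (auto simp: cong_0_iff)
  define h where "h = (int p - 1) div 2"
  have ph: "int p = 2 * h + 1" using p_eq2 h_def by simp
  \<comment> \<open>All these doubles are below \<open>p\<close>, so reduction modulo
    \<open>p\<close> leaves them fixed.\<close>
  have "C = (\<lambda>x. 2 * x) ` {0<..h}"
    unfolding C_def B_def A_def image_image h_def[symmetric]
    by (rule image_cong) (auto simp: ph mult.commute)
  then have "E = (\<lambda>x. 2 * x) ` {h div 2<..h}"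
    unfolding E_def h_def[symmetric] by force
  then have "card E = card {h div 2<..h}"
    by (simp add: card_image inj_on_def)
  also have "\<dots> = nat (h - h div 2)" by simp
  also have "\<dots> = (p - 1) div 2 - (p - 1) div 4"
  proof -
    have "(p - 1) div 2 = nat h" "(p - 1) div 4 = nat (h div 2)" using ph by linarith+
    then show ?thesis using ph by (simp add: nat_diff_distrib)
  qed
  finally show ?thesis using gauss_lemma by simp
qed

text \<open>Writing \<open>p = 8 k + i\<close> with \<open>i\<close> = 1, 3, 5, 7, the exponent from
  Gauss's lemma is \<open>2 k\<close>, \<open>2 k + 1\<close>, \<open>2 k + 1\<close>,
  \<open>2 k + 2\<close>.\<close>

lemma Legendre_2_eq:
  fixes p :: nat
  assumes "prime p" "odd p"
  shows "Legendre 2 p = (if [p = 1] (mod 8) \<or> [p = 7] (mod 8) then 1 else -1)"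
proof -
  have p2: "2 < p" using assms prime_ge_2_nat[of p] by (cases "p = 2") auto
  define k where "k = p div 8"
  have "p mod 8 \<in> {1, 3, 5, 7}" using assms(2) by simp presburger
  then consider "p = 8 * k + 1" | "p = 8 * k + 3" | "p = 8 * k + 5" | "p = 8 * k + 7"
    using k_def mult_div_mod_eq[of 8 p] by fastforce
  then show ?thesis
  proof cases
    case 1
    moreover have "(p - 1) div 2 = 4 * k" "(p - 1) div 4 = 2 * k" using 1 by simp_all
    ultimately show ?thesis using Legendre_2[OF assms(1) p2] by (simp add: cong_def)
  next
    case 2
    moreover have "(p - 1) div 2 = 4 * k + 1" "(p - 1) div 4 = 2 * k" using 2 by simp_all
    ultimately show ?thesis using Legendre_2[OF assms(1) p2] by (simp add: cong_def)
  next
    case 3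
    moreover have "(p - 1) div 2 = 4 * k + 2" "(p - 1) div 4 = 2 * k + 1" using 3 by simp_all
    ultimately show ?thesis using Legendre_2[OF assms(1) p2] by (simp add: cong_def)
  next
    case 4
    moreover have "(p - 1) div 2 = 4 * k + 3" "(p - 1) div 4 = 2 * k + 1" using 4 by simp_all
    ultimately show ?thesis using Legendre_2[OF assms(1) p2] by (simp add: cong_def)
  qed
qed

section \<open>Negative numbers as residues modulo odd primes\<close>

text \<open>Here reciprocity exchanges \<open>p\<close> and \<open>q\<close> without a sign, so the
  only sign left is that of \<open>-1\<close> modulo \<open>q\<close>.\<close>

lemma QuadRes_minus_iff_of_mod_4_eq_1:
  fixes p q :: nat
  assumes "prime p" "[p = 1] (mod 4)" "prime q" "odd q" "p \<noteq> q"
  shows "QuadRes q (- int p) \<longleftrightarrow> Legendre q p = (-1) ^ ((q - 1) div 2)"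
proof -
  have p2: "2 < p" using assms(1,2) prime_ge_2_nat[of p] by (cases "p = 2") (auto simp: cong_def)
  have q2: "2 < q" using assms(3,4) prime_ge_2_nat[of q] by (cases "q = 2") auto
  have "even ((p - 1) div 2)" using assms(2) by (simp add: cong_def) presburger
  then have "Legendre p q * Legendre q p = 1"
    using Quadratic_Reciprocity[OF assms(1) p2 assms(3) q2 assms(5)] by simp
  then have eq: "Legendre p q = Legendre q p"
    using Legendre_values[of p q] Legendre_values[of q p] by auto
  have nd: "\<not> int q dvd - int p" using primes_dvd_imp_eq[OF assms(3,1)] assms(5) by auto
  have "QuadRes q (- int p) \<longleftrightarrow> Legendre (-1 * int p) q = 1"
    using Legendre_eq_1_iff nd by auto
  also have "\<dots> \<longleftrightarrow> (-1) ^ ((q - 1) div 2) * Legendre q p = 1"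
    unfolding Legendre_mult[OF assms(3) q2] Legendre_minus_1[OF assms(3) q2] eq ..
  also have "\<dots> \<longleftrightarrow> Legendre q p = (-1) ^ ((q - 1) div 2)"
    using Legendre_values[of q p] by (cases "even ((q - 1) div 2)") auto
  finally show ?thesis .
qed

text \<open>The sign from reciprocity is \<open>(-1) ^ ((q - 1) div 2)\<close>, the same as that of
  \<open>-1\<close> modulo \<open>q\<close>, and the two cancel.\<close>

lemma QuadRes_minus_iff_of_mod_4_eq_3:
  fixes p q :: nat
  assumes "prime p" "[p = 3] (mod 4)" "prime q" "odd q" "p \<noteq> q"
  shows "QuadRes q (- int p) \<longleftrightarrow> Legendre q p = 1"
proof -
  have p2: "2 < p" using assms(1,2) prime_ge_2_nat[of p] by (cases "p = 2") (auto simp: cong_def)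
  have q2: "2 < q" using assms(3,4) prime_ge_2_nat[of q] by (cases "q = 2") auto
  have "odd ((p - 1) div 2)" using assms(2) by (simp add: cong_def) presburger
  then have "Legendre p q * Legendre q p = (-1) ^ ((q - 1) div 2)"
    using Quadratic_Reciprocity[OF assms(1) p2 assms(3) q2 assms(5)] by (simp add: power_mult)
  then have eq: "(-1) ^ ((q - 1) div 2) * Legendre p q = Legendre q p"
    using Legendre_values[of p q] Legendre_values[of q p] by auto
  have nd: "\<not> int q dvd - int p" using primes_dvd_imp_eq[OF assms(3,1)] assms(5) by auto
  have "QuadRes q (- int p) \<longleftrightarrow> Legendre (-1 * int p) q = 1"
    using Legendre_eq_1_iff nd by auto
  also have "\<dots> \<longleftrightarrow> Legendre q p = 1"
    unfolding Legendre_mult[OF assms(3) q2] Legendre_minus_1[OF assms(3) q2] eq ..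
  finally show ?thesis .
qed

lemma QuadRes_minus_1_iff:
  fixes q :: nat
  assumes "prime q" "odd q"
  shows "QuadRes q (-1) \<longleftrightarrow> [q = 1] (mod 4)"
proof -
  have q2: "2 < q" using assms prime_ge_2_nat[of q] by (cases "q = 2") auto
  have "\<not> int q dvd -1" using q2 by auto
  then have "QuadRes q (-1) \<longleftrightarrow> (-1::int) ^ ((q - 1) div 2) = 1"
    using Legendre_eq_1_iff Legendre_minus_1[OF assms(1) q2] by metis
  also have "\<dots> \<longleftrightarrow> even ((q - 1) div 2)" by (auto simp: minus_one_power_iff)
  also have "\<dots> \<longleftrightarrow> [q = 1] (mod 4)" using assms(2) q2 unfolding cong_def by presburger
  finally show ?thesis .
qed

text \<open>Multiplicativity reduces this to comparing the symbols of \<open>-1\<close> and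
  \<open>2\<close>, which agree exactly for \<open>q\<close> congruent to 1 or 3 modulo 8.\<close>

lemma QuadRes_minus_2_iff:
  fixes q :: nat
  assumes "prime q" "odd q"
  shows "QuadRes q (-2) \<longleftrightarrow> [q = 1] (mod 8) \<or> [q = 3] (mod 8)"
proof -
  have q2: "2 < q" using assms prime_ge_2_nat[of q] by (cases "q = 2") auto
  have "\<not> int q dvd -1" "\<not> int q dvd -2" using q2 zdvd_imp_le[of "int q" 2] by auto
  then have "QuadRes q (-2) \<longleftrightarrow> Legendre (-1 * 2) q = 1"
    and minus_1: "Legendre (-1) q = (if q mod 4 = 1 then 1 else -1)"
    using QuadRes_minus_1_iff[OF assms] by (auto simp: Legendre_def cong_0_iff cong_def)
  moreover have "q mod 8 \<in> {1, 3, 5, 7}" using assms(2) by simp presburger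
  moreover have "q mod 4 = (q mod 8) mod 4" by (simp add: mod_mod_cancel)
  ultimately show ?thesis
    unfolding Legendre_mult[OF assms(1) q2] Legendre_2_eq[OF assms] minus_1
    by (auto simp: cong_def)
qed

text \<open>The sign \<open>(-1) ^ ((q - 1) div 2)\<close> is multiplicative on odd numbers, just as
  the symbol is, so equality of the two passes from the factors to the product.\<close>

lemma Legendre_prod_list:
  fixes p :: nat
  assumes "prime p" "2 < p"
    and "\<And>q. q \<in> set qs \<Longrightarrow> odd q \<and> Legendre (int q) p = (-1) ^ ((q - 1) div 2)"
  shows "odd (prod_list qs) \<and>
    Legendre (int (prod_list qs)) p = (-1) ^ ((prod_list qs - 1) div 2)"
  using assms(3)
proof (induction qs)
  case Nil
  have "QuadRes p 1" unfolding QuadRes_def by (rule exI[of _ 1]) simp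
  then show ?case using assms(1,2) by (simp add: Legendre_eq_1_iff)
next
  case (Cons q qs)
  define m where "m = prod_list qs"
  have q: "odd q" "Legendre (int q) p = (-1) ^ ((q - 1) div 2)" using Cons.prems by auto
  have m: "odd m" "Legendre (int m) p = (-1) ^ ((m - 1) div 2)"
    using Cons by (auto simp: m_def)
  obtain i j where ij: "q = 2 * i + 1" "m = 2 * j + 1"
    using q(1) m(1) by (auto elim!: oddE)
  \<comment> \<open>The mixed term is even, so the exponents of the signs add modulo 2.\<close>
  have "(q * m - 1) div 2 = 2 * (i * j) + (i + j)"
    unfolding ij by (simp add: algebra_simps)
  then have "(-1::int) ^ ((q * m - 1) div 2) = (-1) ^ ((q - 1) div 2) * (-1) ^ ((m - 1) div 2)"
    unfolding ij by (simp add: power_add power_mult)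
  then show ?case using q m Legendre_mult[OF assms(1,2)] by (simp add: m_def[symmetric])
qed

lemma Legendre_prod_list_eq_1:
  fixes p :: nat
  assumes "prime p" "2 < p" "\<And>q. q \<in> set qs \<Longrightarrow> Legendre (int q) p = 1"
  shows "Legendre (int (prod_list qs)) p = 1"
  using assms(3)
proof (induction qs)
  case Nil
  have "QuadRes p 1" unfolding QuadRes_def by (rule exI[of _ 1]) simp
  then show ?case using assms(1,2) by (simp add: Legendre_eq_1_iff)
next
  case (Cons q qs)
  then show ?case using Legendre_mult[OF assms(1,2)] by simp
qed

section \<open>The norm form\<close>

text \<open>For \<open>d > 0\<close> these are the norms from the field generated over the rationals
  by a square root of \<open>- d\<close>, whence the multiplicative behaviour below. The argument is
  real so that squared lengths can be inserted directly.\<close>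

definition norm_form :: "nat \<Rightarrow> real \<Rightarrow> bool" where
  "norm_form d r \<longleftrightarrow> (\<exists>x\<in>\<rat>. \<exists>y\<in>\<rat>. r = x\<^sup>2 + real d * y\<^sup>2)"

lemma norm_formI: "x \<in> \<rat> \<Longrightarrow> y \<in> \<rat> \<Longrightarrow> r = x\<^sup>2 + real d * y\<^sup>2 \<Longrightarrow> norm_form d r"
  unfolding norm_form_def by blast

text \<open>Brahmagupta's identity: the witnesses are the coefficients of the product of
  \<open>x + y sqrt (- d)\<close> and \<open>u + v sqrt (- d)\<close>.\<close>

lemma norm_form_mult:
  assumes "norm_form d r" "norm_form d s"
  shows "norm_form d (r * s)"
proof -
  obtain x y where x: "x \<in> \<rat>" "y \<in> \<rat>" "r = x\<^sup>2 + real d * y\<^sup>2"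
    using assms(1) by (auto simp: norm_form_def)
  obtain u v where u: "u \<in> \<rat>" "v \<in> \<rat>" "s = u\<^sup>2 + real d * v\<^sup>2"
    using assms(2) by (auto simp: norm_form_def)
  show ?thesis
  proof (rule norm_formI)
    show "x * u - d * y * v \<in> \<rat>" "x * v + y * u \<in> \<rat>"
      using x(1,2) u(1,2) by simp_all
    show "r * s = (x * u - d * y * v)\<^sup>2 + d * (x * v + y * u)\<^sup>2"
      unfolding x(3) u(3) by (simp add: power2_eq_square algebra_simps)
  qed
qed

lemma norm_form_square: "(x :: real) \<in> \<rat> \<Longrightarrow> norm_form d (x\<^sup>2)"
  by (rule norm_formI[of x 0]) auto

lemma norm_form_discriminant: "norm_form d d"
  by (rule norm_formI[of 0 1]) auto

lemma norm_form_mult_square_iff: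
  assumes "x \<in> \<rat>" "x \<noteq> 0"
  shows "norm_form d (r * x\<^sup>2) \<longleftrightarrow> norm_form d r"
proof
  assume "norm_form d (r * x\<^sup>2)"
  then have "norm_form d (r * x\<^sup>2 * (inverse x)\<^sup>2)"
    using assms by (intro norm_form_mult[of _ "r * x\<^sup>2"] norm_form_square) auto
  moreover have "r * x\<^sup>2 * (inverse x)\<^sup>2 = r" using assms by (simp add: power_mult_distrib[symmetric] mult.assoc)
  ultimately show "norm_form d r" by metis
qed (use assms norm_form_mult norm_form_square in blast)

text \<open>\<open>inverse r\<close> is \<open>r\<close> times the square of
  \<open>inverse r\<close>. For \<open>r = 0\<close> the convention \<open>inverse 0 = 0\<close>
  makes the claim trivial.\<close>

lemma norm_form_inverse:
  assumes "norm_form d r"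
  shows "norm_form d (inverse r)"
proof (cases "r = 0")
  case False
  have "r \<in> \<rat>" using assms by (auto simp: norm_form_def)
  then have "norm_form d (r * (inverse r)\<^sup>2)"
    using assms norm_form_mult norm_form_square Rats_inverse by blast
  moreover have "r * (inverse r)\<^sup>2 = inverse r" using False by (simp add: power2_eq_square)
  ultimately show ?thesis by simp
qed (use assms in simp)

lemma norm_form_mult_iff:
  assumes "norm_form d s" "s \<noteq> 0"
  shows "norm_form d (s * r) \<longleftrightarrow> norm_form d r"
proof
  assume "norm_form d (s * r)"
  then have "norm_form d (inverse s * (s * r))"
    using assms norm_form_inverse norm_form_mult by blast
  moreover have "inverse s * (s * r) = r" using assms(2) by simp
  ultimately show "norm_form d r" by simp
qed (use assms norm_form_mult in blast)

text \<open>Clearing denominators, with the product of the two denominators as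
  \<open>z\<close>.\<close>

lemma norm_form_of_nat_iff:
  "norm_form d (of_nat n) \<longleftrightarrow>
    (\<exists>x y z :: int. z > 0 \<and> int n * z\<^sup>2 = x\<^sup>2 + int d * y\<^sup>2)"
proof
  assume "norm_form d (of_nat n)"
  then obtain u v where u: "u \<in> \<rat>" "v \<in> \<rat>" "real n = u\<^sup>2 + real d * v\<^sup>2"
    unfolding norm_form_def by blast
  obtain a k where a: "k > 0" "u = of_int a / of_int k" using Rats_cases'[OF u(1)] by metis
  obtain b l where b: "l > 0" "v = of_int b / of_int l" using Rats_cases'[OF u(2)] by metis
  have "real n * (of_int k * of_int l)\<^sup>2 = (of_int a * of_int l)\<^sup>2 + d * (of_int b * of_int k)\<^sup>2"
    unfolding u(3) a(2) b(2) using a(1) b(1) by (simp add: field_simps power2_eq_square)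
  then have "of_int (int n * (k * l)\<^sup>2) = (of_int ((a * l)\<^sup>2 + int d * (b * k)\<^sup>2) :: real)" by simp
  then have "int n * (k * l)\<^sup>2 = (a * l)\<^sup>2 + int d * (b * k)\<^sup>2"
    using of_int_eq_iff by blast
  moreover have "k * l > 0" using a(1) b(1) by simp
  ultimately show "\<exists>x y z :: int. z > 0 \<and> int n * z\<^sup>2 = x\<^sup>2 + int d * y\<^sup>2" by blast
next
  assume "\<exists>x y z :: int. z > 0 \<and> int n * z\<^sup>2 = x\<^sup>2 + int d * y\<^sup>2"
  then obtain x y z :: int where z: "z > 0" "int n * z\<^sup>2 = x\<^sup>2 + int d * y\<^sup>2" by blast
  have "real n * (of_int z)\<^sup>2 = (of_int x)\<^sup>2 + d * (of_int y)\<^sup>2"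
    using arg_cong[OF z(2), of real_of_int] by simp
  then show "norm_form d (of_nat n)"
    using z(1) by (intro norm_formI[of "of_int x / of_int z" "of_int y / of_int z"])
      (auto simp: field_simps power2_eq_square)
qed

section \<open>Legendre's theorem for \<open>x^2 + d y^2 = n z^2\<close>\<close>

text \<open>Since \<open>b\<close> is invertible modulo \<open>n\<close>, multiplying
  \<open>a\<close> by an inverse of \<open>b\<close> gives a square root of
  \<open>k\<close>.\<close>

lemma QuadRes_of_cong_mult_square:
  assumes "coprime b n" "[a\<^sup>2 = k * b\<^sup>2] (mod n)"
  shows "QuadRes n k"
proof -
  obtain c where c: "[b * c = 1] (mod n)" using assms(1) cong_solve_coprime_int by blast
  have "[(a * c)\<^sup>2 = k * (b * c)\<^sup>2] (mod n)"
    using cong_scalar_right[OF assms(2), of "c\<^sup>2"] by (simp add: power_mult_distrib mult.assoc)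
  also have "[k * (b * c)\<^sup>2 = k] (mod n)"
    using cong_scalar_left[OF cong_pow[OF c, of 2], of k] by simp
  finally show ?thesis unfolding QuadRes_def by blast
qed

text \<open>A squarefree \<open>n\<close> contains \<open>q\<close> only once, so the second factor
  \<open>q\<close> must come from \<open>z^2\<close>.\<close>

lemma squarefree_dvd_square_mult:
  fixes n :: nat and q :: int
  assumes "squarefree n" "prime q" "q dvd int n" "q\<^sup>2 dvd int n * z\<^sup>2"
  shows "q dvd z"
proof -
  obtain m where m: "int n = q * m" using assms(3) by blast
  have "\<not> q dvd m"
  proof
    assume "q dvd m"
    then have "q\<^sup>2 dvd int n" by (simp add: m power2_eq_square)
    moreover have "int ((nat q)\<^sup>2) = q\<^sup>2" using assms(2) prime_ge_0_int by simp
    ultimately have "(nat q)\<^sup>2 dvd n" by (metis of_nat_dvd_iff)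
    then have "nat q dvd 1" using assms(1) squarefreeD by blast
    then show False using prime_gt_1_int[OF assms(2)] by simp
  qed
  moreover have "q dvd m * z\<^sup>2"
    using assms(2,4) prime_gt_1_int[OF assms(2)] by (simp add: m power2_eq_square mult.assoc)
  ultimately show ?thesis using assms(2) by (simp add: prime_dvd_mult_iff prime_dvd_power_iff)
qed

lemma coprime_int_nat_primeI:
  fixes n :: nat
  assumes "n > 0" "\<And>q :: int. prime q \<Longrightarrow> q dvd b \<Longrightarrow> q dvd int n \<Longrightarrow> False"
  shows "coprime b (int n)"
proof (rule ccontr)
  assume "\<not> coprime b (int n)"
  then have "gcd b (int n) \<noteq> 1" by (simp add: coprime_iff_gcd_eq_1)
  moreover have "gcd b (int n) > 0" using assms(1) by simp
  ultimately obtain q where "prime q" "q dvd gcd b (int n)"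
    using prime_divisor_exists[of "gcd b (int n)"] by (metis is_unit_gcd_iff less_irrefl)
  then show False using assms(2) by auto
qed

text \<open>The necessity half of Legendre's theorem. In a solution with least positive
  \<open>c\<close> no prime divides all of \<open>x\<close>, \<open>y\<close>, \<open>c\<close>;
  this makes \<open>y\<close> a unit modulo \<open>n\<close> and \<open>c\<close> a unit modulo
  \<open>d\<close>, and reading the equation modulo \<open>n\<close> and modulo \<open>d\<close>
  gives the two residue conditions.\<close>

lemma norm_form_imp_QuadRes:
  assumes "squarefree n" "squarefree d" "norm_form d (of_nat n)"
  shows "QuadRes n (- int d) \<and> QuadRes d n"
proof -
  have pos: "n > 0" "d > 0" using assms(1,2) by (auto intro!: gr0I)
  define P where "P = (\<lambda>c. c > 0 \<and> (\<exists>x y. int n * (int c)\<^sup>2 = x\<^sup>2 + int d * y\<^sup>2))"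
  obtain x y z where z: "z > 0" "int n * z\<^sup>2 = x\<^sup>2 + int d * y\<^sup>2"
    using assms(3) norm_form_of_nat_iff by blast
  then have "P (nat z)" unfolding P_def by auto
  then obtain c where c: "P c" "\<And>k. k < c \<Longrightarrow> \<not> P k"
    using exists_least_iff[of P] by blast
  then obtain x y where xy: "int n * (int c)\<^sup>2 = x\<^sup>2 + int d * y\<^sup>2" and c0: "c > 0"
    unfolding P_def by blast
  have descent: False if q: "prime q" "q dvd x" "q dvd y" "q dvd int c" for q
  proof -
    obtain x' y' c' where e: "x = q * x'" "y = q * y'" "int c = q * c'"
      using q(2-4) by (auto elim!: dvdE)
    have q1: "q > 1" using q(1) prime_gt_1_int by blast
    have c': "c' > 0" using e(3) c0 q1 by (metis of_nat_0_less_iff zero_less_mult_pos order.strict_trans zero_less_one)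
    have "q\<^sup>2 * (int n * c'\<^sup>2) = q\<^sup>2 * (x'\<^sup>2 + int d * y'\<^sup>2)"
      using xy unfolding e by (simp add: power_mult_distrib algebra_simps)
    then have "int n * c'\<^sup>2 = x'\<^sup>2 + int d * y'\<^sup>2" using q1 by simp
    then have "P (nat c')" unfolding P_def using c' by auto
    moreover have "nat c' < c" using e(3) q1 c' by (simp add: nat_less_iff)
    ultimately show False using c(2) by blast
  qed
  \<comment> \<open>A prime dividing \<open>y\<close> and \<open>n\<close> divides \<open>x\<close>;
    then its square divides \<open>n c^2\<close>, and squarefreeness of \<open>n\<close> forces it
    into \<open>c\<close>.\<close>
  have "coprime y (int n)"
  proof (rule coprime_int_nat_primeI[OF pos(1)])
    fix q :: int assume q: "prime q" "q dvd y" "q dvd int n"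
    have "q dvd x\<^sup>2 + int d * y\<^sup>2" using q(3) xy by (metis dvd_mult2)
    moreover have "q dvd int d * y\<^sup>2" using q(2) by (simp add: power2_eq_square)
    ultimately have "q dvd x" using q(1) dvd_add_left_iff prime_dvd_power by blast
    moreover from this have "q\<^sup>2 dvd int n * (int c)\<^sup>2"
      unfolding xy using q(2) by (intro dvd_add dvd_mult) (auto simp: dvd_power_same)
    then have "q dvd int c" using squarefree_dvd_square_mult[OF assms(1) q(1,3)] by blast
    ultimately show False using descent q by blast
  qed
  moreover have "[x\<^sup>2 = - int d * y\<^sup>2] (mod int n)"
  proof -
    have "x\<^sup>2 - - int d * y\<^sup>2 = int n * (int c)\<^sup>2" using xy by simp
    then show ?thesis by (simp add: cong_iff_dvd_diff)
  qed
  \<comment> \<open>The roles change: a prime dividing \<open>c\<close> and \<open>d\<close> divides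
    \<open>x\<close>, and squarefreeness of \<open>d\<close> forces it into
    \<open>y\<close>.\<close>
  moreover have "coprime (int c) (int d)"
  proof (rule coprime_int_nat_primeI[OF pos(2)])
    fix q :: int assume q: "prime q" "q dvd int c" "q dvd int d"
    have "q dvd x\<^sup>2 + int d * y\<^sup>2" unfolding xy[symmetric] using q(2) by (simp add: power2_eq_square)
    moreover have "q dvd int d * y\<^sup>2" using q(3) by simp
    ultimately have qx: "q dvd x" using q(1) dvd_add_left_iff prime_dvd_power by blast
    have "q\<^sup>2 dvd int n * (int c)\<^sup>2 - x\<^sup>2"
      using q(2) qx by (intro dvd_diff dvd_mult) (auto simp: dvd_power_same)
    then have "q\<^sup>2 dvd int d * y\<^sup>2" using xy by simp
    then have "q dvd y" using squarefree_dvd_square_mult[OF assms(2) q(1,3)] by blast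
    then show False using descent q qx by blast
  qed
  moreover have "[x\<^sup>2 = int n * (int c)\<^sup>2] (mod int d)"
  proof -
    have "x\<^sup>2 - int n * (int c)\<^sup>2 = int d * (- y\<^sup>2)" using xy by simp
    then show ?thesis by (metis cong_iff_dvd_diff dvd_triv_left)
  qed
  ultimately show ?thesis using QuadRes_of_cong_mult_square by blast
qed

text \<open>An integer below the ceiling of \<open>sqrt m\<close> is already below
  \<open>sqrt m\<close> itself. This keeps the bounds in the pigeonhole argument strict.\<close>

lemma square_diff_less_of_ceiling_sqrt:
  fixes x x' :: int and m :: nat
  assumes "x \<in> {0..<\<lceil>sqrt m\<rceil>}" "x' \<in> {0..<\<lceil>sqrt m\<rceil>}"
  shows "(x - x')\<^sup>2 < int m"
proof -
  have "\<bar>x - x'\<bar> < \<lceil>sqrt m\<rceil>" using assms by auto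
  then have "of_int \<bar>x - x'\<bar> < sqrt m" by linarith
  then have "(of_int \<bar>x - x'\<bar>)\<^sup>2 < (sqrt m)\<^sup>2" by (intro power_strict_mono) auto
  then have "of_int ((x - x')\<^sup>2) < (of_int (int m) :: real)" by simp
  then show ?thesis using of_int_less_iff by blast
qed

text \<open>
  Mordell's pigeonhole proof of Legendre's theorem: the congruences \<open>u \<equiv> s w (mod d)\<close> and
  \<open>u \<equiv> t v (mod n)\<close> have a nonzero solution in a box that forces
  \<open>V = u\<^sup>2 + d v\<^sup>2 - n w\<^sup>2\<close> to be \<open>0\<close> or \<open>d n\<close>. In the latter case
  \<open>n (w\<^sup>2 + d) = u\<^sup>2 + d v\<^sup>2\<close>, so \<open>n\<close> is a quotient of two values of the form.
\<close>

lemma QuadRes_imp_norm_form: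
  assumes "squarefree n" "squarefree d" "coprime n d"
    and "QuadRes n (- int d)" "QuadRes d n"
  shows "norm_form d (of_nat n)"
\<comment> \<open>The case \<open>n = 1\<close> is set apart so that \<open>d * n\<close> is a
  squarefree number other than 1, hence not a perfect square.\<close>
proof (cases "n = 1")
  case True
  then show ?thesis by (intro norm_formI[of 1 0]) auto
next
  case False
  have pos: "n > 0" "d > 0" using assms(1,2) by (auto intro!: gr0I)
  obtain t where t: "[t\<^sup>2 = - int d] (mod n)" using assms(4) by (auto simp: QuadRes_def)
  obtain s where s: "[s\<^sup>2 = int n] (mod int d)" using assms(5) by (auto simp: QuadRes_def)
  have strict: "sqrt (d * n) < \<lceil>sqrt (d * n)\<rceil>"
  proof (rule ccontr)
    assume "\<not> ?thesis"
    then have "sqrt (d * n) = \<lceil>sqrt (d * n)\<rceil>" using le_of_int_ceiling[of "sqrt (d * n)"] by linarith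
    then have "real_of_int (\<lceil>sqrt (d * n)\<rceil>\<^sup>2) = real_of_int (int (d * n))"
      by (metis of_int_power of_int_of_nat_eq of_nat_0_le_iff real_sqrt_pow2)
    then have "\<lceil>sqrt (d * n)\<rceil>\<^sup>2 = int (d * n)" using of_int_eq_iff by blast
    then have "int ((nat \<bar>\<lceil>sqrt (d * n)\<rceil>\<bar>)\<^sup>2) = int (d * n)" by simp
    then have eq: "(nat \<bar>\<lceil>sqrt (d * n)\<rceil>\<bar>)\<^sup>2 = d * n" using of_nat_eq_iff by blast
    have "squarefree (d * n)"
      using assms(1-3) squarefree_mult_coprime coprime_commute by blast
    then have "nat \<bar>\<lceil>sqrt (d * n)\<rceil>\<bar> dvd 1" using squarefreeD eq by (metis dvd_refl)
    then have "d * n = 1" using eq by simp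
    then show False using False by simp
  qed
  \<comment> \<open>The box has more than \<open>d * n\<close> points, while \<open>f\<close> takes
    at most \<open>d * n\<close> values; a collision solves both congruences. The excess is strict
    because \<open>sqrt (d * n)\<close> is not an integer.\<close>
  define X where "X = {0..<\<lceil>sqrt (d * n)\<rceil>} \<times> {0..<\<lceil>sqrt n\<rceil>} \<times> {0..<\<lceil>sqrt d\<rceil>}"
  define f where "f = (\<lambda>(x, y, z). ((x - s * z) mod int d, (x - t * y) mod int n))"
  define Y where "Y = {0..<int d} \<times> {0..<int n}"
  have fY: "f ` X \<subseteq> Y" unfolding f_def Y_def using pos by auto
  have finY: "finite Y" unfolding Y_def by simp
  have cardX: "real (card X) = of_int \<lceil>sqrt (d * n)\<rceil> * (of_int \<lceil>sqrt n\<rceil> * of_int \<lceil>sqrt d\<rceil>)"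
    unfolding X_def by (simp add: card_cartesian_product)
  have "real (d * n) = sqrt (d * n) * (sqrt n * sqrt d)"
    by (simp add: real_sqrt_mult power_mult_distrib mult.commute[of "sqrt n"] flip: power2_eq_square)
  also have "\<dots> < of_int \<lceil>sqrt (d * n)\<rceil> * (of_int \<lceil>sqrt n\<rceil> * of_int \<lceil>sqrt d\<rceil>)"
    using pos by (intro mult_less_le_imp_less mult_mono strict) (auto intro: less_le_trans[of _ 0])
  finally have "d * n < card X" unfolding cardX[symmetric] by linarith
  moreover have "card Y = d * n" unfolding Y_def by simp
  ultimately have "\<not> inj_on f X" using card_inj_on_le[OF _ fY finY] by linarith
  then obtain x y z x' y' z' where
    in_X: "(x, y, z) \<in> X" "(x', y', z') \<in> X" and ne: "(x, y, z) \<noteq> (x', y', z')"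
    and eq: "f (x, y, z) = f (x', y', z')"
    unfolding inj_on_def by (metis prod_cases3)
  define u v w where "u = x - x'" and "v = y - y'" and "w = z - z'"
  have bounds: "u\<^sup>2 < int (d * n)" "v\<^sup>2 < int n" "w\<^sup>2 < int d"
    unfolding u_def v_def w_def
    using in_X by (auto intro!: square_diff_less_of_ceiling_sqrt simp: X_def simp del: of_nat_mult)
  have "[x - s * z = x' - s * z'] (mod d)" "[x - t * y = x' - t * y'] (mod n)"
    using eq by (auto simp: f_def cong_def)
  then have "[u = s * w] (mod d)" "[u = t * v] (mod n)"
    unfolding cong_iff_dvd_diff u_def v_def w_def by (simp_all add: algebra_simps)
  then have "[u\<^sup>2 = s\<^sup>2 * w\<^sup>2] (mod d)" "[u\<^sup>2 = t\<^sup>2 * v\<^sup>2] (mod n)"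
    using cong_pow power_mult_distrib by metis+
  then have "[u\<^sup>2 = n * w\<^sup>2] (mod d)" "[u\<^sup>2 = - int d * v\<^sup>2] (mod n)"
    using cong_trans cong_scalar_right[OF s] cong_scalar_right[OF t] by blast+
  then have dvds: "int d dvd u\<^sup>2 - n * w\<^sup>2" "int n dvd u\<^sup>2 + d * v\<^sup>2"
    unfolding cong_iff_dvd_diff by simp_all
  define V where "V = u\<^sup>2 + d * v\<^sup>2 - n * w\<^sup>2"
  have "int d dvd V"
    using dvd_add[OF dvds(1), of "d * v\<^sup>2"] unfolding V_def by (simp add: algebra_simps)
  moreover have "int n dvd V" using dvd_diff[OF dvds(2), of "n * w\<^sup>2"] unfolding V_def by simp
  ultimately have "int d * int n dvd V"
    using assms(3) by (intro divides_mult) (auto simp: coprime_commute)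
  then obtain k where k: "V = int (d * n) * k" by (auto elim!: dvdE)
  \<comment> \<open>Together with \<open>u^2 < d n\<close> these bounds place \<open>V\<close>, a
    multiple of \<open>d n\<close>, strictly between \<open>- d n\<close> and
    \<open>2 d n\<close>.\<close>
  have "int d * v\<^sup>2 < int (d * n)" "int n * w\<^sup>2 < int (n * d)"
    unfolding of_nat_mult using bounds pos by (auto intro!: mult_strict_left_mono)
  moreover have "0 \<le> u\<^sup>2" "0 \<le> int d * v\<^sup>2" "0 \<le> int n * w\<^sup>2" by auto
  ultimately have "V < int (d * n) * 2" "int (d * n) * (-1) < V"
    using bounds(1) unfolding V_def mult.commute[of n d] by linarith+
  moreover have "int (d * n) > 0" using pos by simp
  ultimately have "k < 2" "-1 < k" unfolding k using mult_less_cancel_left_pos by blast+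
  then consider "k = 0" | "k = 1" by linarith
  then show ?thesis
  proof cases
    case 1
    then have eq: "int n * w\<^sup>2 = u\<^sup>2 + int d * v\<^sup>2" using k V_def by simp
    \<comment> \<open>If \<open>w\<close> vanished, positivity of the form would force
      \<open>u = v = 0\<close>, and the colliding points would coincide.\<close>
    have "w \<noteq> 0"
    proof
      assume "w = 0"
      then have "u\<^sup>2 + int d * v\<^sup>2 = 0" using eq by simp
      moreover have "0 \<le> u\<^sup>2" "0 \<le> int d * v\<^sup>2" by auto
      ultimately have "u\<^sup>2 = 0" "int d * v\<^sup>2 = 0" by linarith+
      then show False using ne \<open>w = 0\<close> pos by (auto simp: u_def v_def w_def)
    qed
    then have "\<bar>w\<bar> > 0" "int n * \<bar>w\<bar>\<^sup>2 = u\<^sup>2 + int d * v\<^sup>2" using eq by auto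
    then show ?thesis using norm_form_of_nat_iff by blast
  next
    case 2
    then have "int n * (w\<^sup>2 + int d) = u\<^sup>2 + int d * v\<^sup>2" using k V_def by (simp add: algebra_simps)
    from arg_cong[OF this, of real_of_int]
    have eq: "((real_of_int w)\<^sup>2 + real d) * real n = (of_int u)\<^sup>2 + real d * (of_int v)\<^sup>2" by (simp add: mult.commute)
    have "norm_form d ((real_of_int w)\<^sup>2 + real d)" by (rule norm_formI[of "of_int w" 1]) auto
    moreover have "norm_form d (((real_of_int w)\<^sup>2 + real d) * real n)"
      unfolding eq by (rule norm_formI[of "of_int u" "of_int v"]) auto
    moreover have "(of_int w)\<^sup>2 + real d > 0" using pos by (simp add: add_nonneg_pos)
    ultimately show ?thesis using norm_form_mult_iff by (metis less_irrefl)
  qed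
qed

lemma norm_form_iff_QuadRes:
  assumes "squarefree n" "squarefree d" "coprime n d"
  shows "norm_form d (of_nat n) \<longleftrightarrow> QuadRes n (- int d) \<and> QuadRes d n"
  using assms norm_form_imp_QuadRes QuadRes_imp_norm_form by blast

section \<open>Values of the norm form in terms of prime factors\<close>

text \<open>Bridge between the products \<open>q_1 ... q_t\<close> of the theorem and conditions on
  all prime divisors, which is what Legendre's theorem yields. The list comes from the prime
  factorization.\<close>

lemma ex_prime_list_iff:
  fixes m :: nat
  shows "(\<exists>qs. (\<forall>q\<in>set qs. prime q \<and> P q) \<and> m = prod_list qs) \<longleftrightarrow>
    m \<noteq> 0 \<and> (\<forall>q. prime q \<longrightarrow> q dvd m \<longrightarrow> P q)"
proof (intro iffI conjI allI impI)
  assume "m \<noteq> 0 \<and> (\<forall>q. prime q \<longrightarrow> q dvd m \<longrightarrow> P q)"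
  then have m: "m \<noteq> 0" "\<And>q. prime q \<Longrightarrow> q dvd m \<Longrightarrow> P q" by blast+
  obtain qs where qs: "mset qs = prime_factorization m" using ex_mset by blast
  have "prod_list qs = m"
    using prod_mset_prime_factorization_nat[of m] m(1) qs by (metis gr0I prod_mset_prod_list)
  moreover have "set qs = prime_factors m" using qs set_mset_mset by metis
  ultimately show "\<exists>qs. (\<forall>q\<in>set qs. prime q \<and> P q) \<and> m = prod_list qs"
    using m(2) in_prime_factors_iff by metis
next
  assume "\<exists>qs. (\<forall>q\<in>set qs. prime q \<and> P q) \<and> m = prod_list qs"
  then obtain qs where qs: "\<forall>q\<in>set qs. prime q \<and> P q" "m = prod_list qs" by blast
  show "m \<noteq> 0" using qs by (auto simp: prod_list_zero_iff)
  fix q assume q: "prime q" "q dvd m"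
  have "q \<in> set qs" using qs q(2) unfolding qs(2)
  proof (induction qs)
    case (Cons r qs)
    then show ?case using q(1) by (auto simp: prime_dvd_mult_iff primes_dvd_imp_eq)
  qed (use q(1) in auto)
  then show "P q" using qs(1) by blast
qed

text \<open>Source of the exponents in \<open>{0, 1}\<close>: a prime occurs at most once in a
  squarefree number.\<close>

lemma squarefree_prime_split:
  fixes n :: nat
  assumes "squarefree n" "prime p"
  obtains b m where "b \<in> {0, 1::nat}" "n = p ^ b * m" "\<not> p dvd m" "squarefree m"
proof (cases "p dvd n")
  case True
  then obtain m where m: "n = p * m" by blast
  have "\<not> p dvd m"
    using squarefree_mult_imp_coprime[of p m] assms m
    by (metis coprime_absorb_left not_prime_unit)
  then show ?thesis using that[of 1 m] m assms(1) squarefree_multD by auto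
qed (use that[of 0 n] assms in auto)

text \<open>The exponent of 2 stays free because \<open>P\<close> is required of odd primes
  only.\<close>

lemma ex_two_power_prime_list_iff:
  fixes n :: nat
  assumes "squarefree n"
  shows "(\<exists>b\<in>{0, 1::nat}. \<exists>qs. (\<forall>q\<in>set qs. prime q \<and> odd q \<and> P q) \<and> n = 2 ^ b * prod_list qs) \<longleftrightarrow>
    (\<forall>q. prime q \<longrightarrow> odd q \<longrightarrow> q dvd n \<longrightarrow> P q)" (is "?L \<longleftrightarrow> ?R")
proof
  assume ?L
  then obtain b :: nat and m where m: "n = 2 ^ b * m"
    and "\<exists>qs. (\<forall>q\<in>set qs. prime q \<and> odd q \<and> P q) \<and> m = prod_list qs" by blast
  then have mq: "\<And>q. prime q \<Longrightarrow> q dvd m \<Longrightarrow> P q" by (subst (asm) ex_prime_list_iff) blast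
  show ?R
  proof (intro allI impI)
    fix q assume q: "prime q" "odd q" "q dvd n"
    then have "q dvd m" unfolding m
      by (metis prime_dvd_mult_iff prime_dvd_power primes_dvd_imp_eq two_is_prime_nat dvd_refl)
    then show "P q" using mq q by blast
  qed
next
  assume R: ?R
  obtain b m where m: "b \<in> {0, 1::nat}" "n = 2 ^ b * m" "odd m" "squarefree m"
    using squarefree_prime_split[OF assms two_is_prime_nat] by metis
  have "m \<noteq> 0 \<and> (\<forall>q. prime q \<longrightarrow> q dvd m \<longrightarrow> odd q \<and> P q)"
    using m R by (auto intro: dvd_trans)
  then have "\<exists>qs. (\<forall>q\<in>set qs. prime q \<and> odd q \<and> P q) \<and> m = prod_list qs"
    using ex_prime_list_iff[of "\<lambda>q. odd q \<and> P q" m] by blast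
  then show ?L using m(1,2) by blast
qed

text \<open>\<open>p\<close> is itself a value of the form, so its power can be divided out. The
  cofactor \<open>m\<close> is coprime to \<open>p\<close>, and Legendre's theorem applies; its
  condition modulo \<open>m\<close> is tested prime by prime.\<close>

lemma norm_form_prime_iff:
  fixes p m :: nat
  assumes "prime p" "squarefree m" "\<not> p dvd m"
  shows "norm_form p (of_nat (p ^ b * m)) \<longleftrightarrow>
    (\<forall>q. prime q \<longrightarrow> odd q \<longrightarrow> q dvd m \<longrightarrow> QuadRes q (- int p)) \<and> QuadRes p m"
proof -
  have "norm_form p (of_nat (p ^ b * m)) \<longleftrightarrow> norm_form p (of_nat m)"
  proof (induction b)
    case (Suc b)
    then show ?case using norm_form_mult_iff[OF norm_form_discriminant, of p "of_nat (p ^ b * m)"]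
        prime_gt_0_nat[OF assms(1)] by (simp add: mult.assoc)
  qed simp
  also have "\<dots> \<longleftrightarrow> QuadRes m (- int p) \<and> QuadRes p m"
    using assms by (intro norm_form_iff_QuadRes)
      (auto simp: squarefree_prime coprime_commute[of m] intro: prime_imp_coprime)
  also have "QuadRes m (- int p) \<longleftrightarrow>
      (\<forall>q. prime q \<longrightarrow> q dvd m \<longrightarrow> QuadRes q (- int p))"
    by (rule QuadRes_squarefree_iff[OF assms(2)])
  also have "\<dots> \<longleftrightarrow> (\<forall>q. prime q \<longrightarrow> odd q \<longrightarrow> q dvd m \<longrightarrow> QuadRes q (- int p))"
    using QuadRes_2 by (metis of_nat_numeral primes_dvd_imp_eq two_is_prime_nat)
  finally show ?thesis .
qed

lemma norm_form_1_iff: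
  fixes n :: nat
  assumes "squarefree n"
  shows "norm_form 1 (of_nat n) \<longleftrightarrow>
    (\<exists>b\<in>{0, 1::nat}. \<exists>qs. (\<forall>q\<in>set qs. prime q \<and> odd q \<and> [q = 1] (mod 4)) \<and> n = 2 ^ b * prod_list qs)"
proof -
  have "norm_form 1 (of_nat n) \<longleftrightarrow> QuadRes n (- 1)"
    using norm_form_iff_QuadRes[OF assms, of 1] QuadRes_1 by simp
  also have "\<dots> \<longleftrightarrow> (\<forall>q. prime q \<longrightarrow> q dvd n \<longrightarrow> QuadRes q (- 1))"
    by (rule QuadRes_squarefree_iff[OF assms])
  also have "\<dots> \<longleftrightarrow> (\<forall>q. prime q \<longrightarrow> odd q \<longrightarrow> q dvd n \<longrightarrow> [q = 1] (mod 4))"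
    using QuadRes_2 QuadRes_minus_1_iff by (metis of_nat_numeral primes_dvd_imp_eq two_is_prime_nat)
  finally show ?thesis unfolding ex_two_power_prime_list_iff[OF assms] .
qed

lemma norm_form_2_iff:
  fixes n :: nat
  assumes "squarefree n"
  shows "norm_form 2 (of_nat n) \<longleftrightarrow>
    (\<exists>b\<in>{0, 1::nat}. \<exists>qs. (\<forall>q\<in>set qs. prime q \<and> odd q \<and> ([q = 1] (mod 8) \<or> [q = 3] (mod 8))) \<and>
      n = 2 ^ b * prod_list qs)"
proof -
  obtain b m where m: "b \<in> {0, 1::nat}" "n = 2 ^ b * m" "odd m" "squarefree m"
    using squarefree_prime_split[OF assms two_is_prime_nat] by metis
  have "norm_form 2 (of_nat n) \<longleftrightarrow> (\<forall>q. prime q \<longrightarrow> odd q \<longrightarrow> q dvd m \<longrightarrow> QuadRes q (- 2))"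
    using norm_form_prime_iff[OF two_is_prime_nat m(4,3), of b] QuadRes_2 m(2) by simp
  also have "\<dots> \<longleftrightarrow> (\<forall>q. prime q \<longrightarrow> odd q \<longrightarrow> q dvd n \<longrightarrow> [q = 1] (mod 8) \<or> [q = 3] (mod 8))"
  proof -
    have "q dvd n \<longleftrightarrow> q dvd m" if "prime q" "odd q" for q
      using that unfolding m(2)
      by (metis prime_dvd_mult_iff prime_dvd_power primes_dvd_imp_eq two_is_prime_nat dvd_refl)
    then show ?thesis using QuadRes_minus_2_iff by blast
  qed
  finally show ?thesis unfolding ex_two_power_prime_list_iff[OF assms] .
qed

text \<open>The residue condition modulo \<open>p\<close> on the cofactor
  \<open>2 ^ b * q_1 ... q_t\<close> becomes the sign equation, since each symbol of
  \<open>q_j\<close> is a known sign. Leaving \<open>Legendre 2 p\<close> symbolic serves both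
  classes 1 and 5 modulo 8.\<close>

lemma norm_form_prime_iff_of_mod_4_eq_1:
  fixes p n :: nat
  assumes "prime p" "[p = 1] (mod 4)" "squarefree n"
  shows "norm_form p (of_nat n) \<longleftrightarrow>
    (\<exists>b\<in>{0, 1::nat}. \<exists>b'\<in>{0, 1::nat}. \<exists>qs.
       (\<forall>q\<in>set qs. prime q \<and> odd q \<and> Legendre (int q) (int p) = (- 1) ^ ((q - 1) div 2)) \<and>
       Legendre 2 p ^ b * (-1) ^ ((prod_list qs - 1) div 2) = 1 \<and>
       n = 2 ^ b * p ^ b' * prod_list qs)" (is "?L \<longleftrightarrow> ?R")
proof -
  have p2: "2 < p" using assms(1,2) prime_ge_2_nat[of p] by (cases "p = 2") (auto simp: cong_def)
  have odd_p: "odd p" using assms(1) p2 prime_odd_nat by blast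
  have Leg_pow: "Legendre (int (2 ^ b * m)) p = Legendre 2 p ^ b * Legendre m p"
    if "b \<in> {0, 1}" for b m :: nat
    using that Legendre_mult[OF assms(1) p2, of 2 "int m"] by auto
  show ?thesis
  proof
    assume ?L
    obtain b' k where k: "b' \<in> {0, 1::nat}" "n = p ^ b' * k" "\<not> p dvd k" "squarefree k"
      using squarefree_prime_split[OF assms(3,1)] by metis
    obtain b m where m: "b \<in> {0, 1::nat}" "k = 2 ^ b * m" "odd m" "squarefree m"
      using squarefree_prime_split[OF k(4) two_is_prime_nat] by metis
    have *: "\<And>q. prime q \<Longrightarrow> odd q \<Longrightarrow> q dvd k \<Longrightarrow> QuadRes q (- int p)" and **: "QuadRes p k"
      using \<open>?L\<close> norm_form_prime_iff[OF assms(1) k(4,3), of b'] k(2) by auto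
    have "Legendre (int q) p = (- 1) ^ ((q - 1) div 2)" if "prime q" "q dvd m" for q
    proof -
      have q: "odd q" "q dvd k" using that(2) m by (auto intro: dvd_trans)
      then have "p \<noteq> q" using k(3) by auto
      then show ?thesis using * q that(1) QuadRes_minus_iff_of_mod_4_eq_1[OF assms(1,2)] by blast
    qed
    then have "m \<noteq> 0 \<and> (\<forall>q. prime q \<longrightarrow> q dvd m \<longrightarrow> odd q \<and> Legendre (int q) p = (- 1) ^ ((q - 1) div 2))"
      using m(3) by (auto intro: dvd_trans)
    then obtain qs where qs: "\<forall>q\<in>set qs. prime q \<and> odd q \<and> Legendre (int q) p = (- 1) ^ ((q - 1) div 2)"
        "m = prod_list qs"
      by (subst (asm) ex_prime_list_iff[symmetric]) blast
    have "Legendre k p = 1" using ** k(3) by (simp add: Legendre_eq_1_iff)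
    then have "Legendre 2 p ^ b * Legendre m p = 1" using Leg_pow[OF m(1)] m(2) by simp
    then have "Legendre 2 p ^ b * (-1) ^ ((m - 1) div 2) = 1"
      using Legendre_prod_list[OF assms(1) p2, of qs] qs by simp
    moreover have "n = 2 ^ b * p ^ b' * prod_list qs" using k m qs by simp
    ultimately show ?R using m(1) k(1) qs by blast
  next
    assume ?R
    then obtain b b' qs where b: "b \<in> {0, 1::nat}" "b' \<in> {0, 1::nat}"
      and qs: "\<forall>q\<in>set qs. prime q \<and> odd q \<and> Legendre (int q) p = (- 1) ^ ((q - 1) div 2)"
      and e: "Legendre 2 p ^ b * (-1) ^ ((prod_list qs - 1) div 2) = 1"
      and n: "n = 2 ^ b * p ^ b' * prod_list qs" by blast
    define m where "m = prod_list qs"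
    have "m \<noteq> 0 \<and> (\<forall>q. prime q \<longrightarrow> q dvd m \<longrightarrow> odd q \<and> Legendre (int q) p = (- 1) ^ ((q - 1) div 2))"
      using qs m_def by (subst ex_prime_list_iff[symmetric]) blast
    then have mq: "odd q" "Legendre (int q) p = (- 1) ^ ((q - 1) div 2)" if "prime q" "q dvd m" for q
      using that by blast+
    have "Legendre m p = (-1) ^ ((m - 1) div 2)"
      using Legendre_prod_list[OF assms(1) p2, of qs] qs m_def by blast
    then have "Legendre (int (2 ^ b * m)) p = 1" using e Leg_pow[OF b(1)] m_def by simp
    then have k: "\<not> p dvd 2 ^ b * m" "QuadRes p (int (2 ^ b * m))"
      unfolding Legendre_eq_1_iff of_nat_dvd_iff by blast+
    have sq: "squarefree (2 ^ b * m)"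
      using assms(3) unfolding n m_def[symmetric] by (rule squarefree_mono[rotated]) simp
    have "QuadRes q (- int p)" if q: "prime q" "odd q" "q dvd 2 ^ b * m" for q
    proof -
      have "q dvd m" using q
        by (metis prime_dvd_mult_iff prime_dvd_power primes_dvd_imp_eq two_is_prime_nat dvd_refl)
      moreover have "p \<noteq> q" using q(3) k(1) by auto
      ultimately show ?thesis using QuadRes_minus_iff_of_mod_4_eq_1[OF assms(1,2)] q mq by blast
    qed
    then have "norm_form p (of_nat (p ^ b' * (2 ^ b * m)))"
      using norm_form_prime_iff[OF assms(1) sq k(1)] k(2) by blast
    then show ?L by (simp add: n m_def mult_ac)
  qed
qed

text \<open>Here 2 is a residue modulo \<open>p\<close>, so \<open>b\<close> drops out of the sign
  equation.\<close>

lemma norm_form_prime_iff_of_mod_8_eq_1: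
  fixes p n :: nat
  assumes "prime p" "[p = 1] (mod 8)" "squarefree n"
  shows "norm_form p (of_nat n) \<longleftrightarrow>
    (\<exists>b\<in>{0, 1::nat}. \<exists>b'\<in>{0, 1::nat}. \<exists>qs.
       (\<forall>q\<in>set qs. prime q \<and> odd q \<and> Legendre (int q) (int p) = (- 1) ^ ((q - 1) div 2)) \<and>
       even ((prod_list qs - 1) div 2) \<and>
       n = 2 ^ b * p ^ b' * prod_list qs)"
proof -
  have m4: "[p = 1] (mod 4)" using assms(2) cong_dvd_modulus_nat[of p 1 8 4] by simp
  have "odd p" using assms(2) cong_dvd_modulus_nat[of p 1 8 2] by (simp add: cong_def odd_iff_mod_2_eq_one)
  then have "Legendre 2 p = 1" using Legendre_2_eq assms(1,2) by simp
  then have "Legendre 2 p ^ b * (-1) ^ i = 1 \<longleftrightarrow> even i" for b i :: nat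
    by (simp add: minus_one_power_iff)
  then show ?thesis unfolding norm_form_prime_iff_of_mod_4_eq_1[OF assms(1) m4 assms(3)] by simp
qed

text \<open>Here 2 is a non-residue modulo \<open>p\<close>, so the sign equation ties
  \<open>b\<close> to the parity: the two alternatives are the exponents 0 and 1 of 2.\<close>

lemma norm_form_prime_iff_of_mod_8_eq_5:
  fixes p n :: nat
  assumes "prime p" "[p = 5] (mod 8)" "squarefree n"
  shows "norm_form p (of_nat n) \<longleftrightarrow>
    (\<exists>b\<in>{0, 1::nat}. \<exists>qs.
       (\<forall>q\<in>set qs. prime q \<and> odd q \<and> Legendre (int q) (int p) = (- 1) ^ ((q - 1) div 2)) \<and>
       even ((prod_list qs - 1) div 2) \<and>
       n = p ^ b * prod_list qs) \<or>
    (\<exists>b\<in>{0, 1::nat}. \<exists>qs.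
       (\<forall>q\<in>set qs. prime q \<and> odd q \<and> Legendre (int q) (int p) = (- 1) ^ ((q - 1) div 2)) \<and>
       odd ((prod_list qs - 1) div 2) \<and>
       n = 2 * p ^ b * prod_list qs)"
proof -
  have m4: "[p = 1] (mod 4)" using assms(2) cong_dvd_modulus_nat[of p 5 8 4] by (simp add: cong_def)
  have p8: "p mod 8 = 5" using assms(2) by (simp add: cong_def)
  then have "odd p" by presburger
  then have L2: "Legendre 2 p = -1" using Legendre_2_eq assms(1) p8 by (simp add: cong_def)
  have sign: "(-1) ^ i = (1 :: int) \<longleftrightarrow> even i" "-1 * (-1) ^ i = (1 :: int) \<longleftrightarrow> odd i" for i :: nat
    by (simp_all add: minus_one_power_iff)
  show ?thesis unfolding norm_form_prime_iff_of_mod_4_eq_1[OF assms(1) m4 assms(3)]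
    by (simp only: L2 bex_simps power_0 power_one_right mult_1_left sign simp_thms)
qed

text \<open>Up to the square 4, doubling cancels the factor 2 of an even \<open>n\<close> and leads
  back to the plain criterion; an odd \<open>n\<close> gains a factor 2, which makes it
  fail.\<close>

lemma norm_form_double_prime_iff_of_mod_8_eq_3:
  fixes p n :: nat
  assumes "prime p" "[p = 3] (mod 8)" "squarefree n"
  shows "norm_form p (2 * of_nat n) \<longleftrightarrow>
    (\<exists>b\<in>{0, 1::nat}. \<exists>qs.
       (\<forall>q\<in>set qs. prime q \<and> odd q \<and> Legendre (int q) (int p) = 1) \<and>
       n = 2 * p ^ b * prod_list qs)" (is "?L \<longleftrightarrow> ?R")
proof -
  have p8: "p mod 8 = 3" using assms(2) by (simp add: cong_def)
  have m4: "[p = 3] (mod 4)" using assms(2) cong_dvd_modulus_nat[of p 3 8 4] by simp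
  have odd_p: "odd p" using p8 by presburger
  have p2: "2 < p" using assms(1) odd_p prime_ge_2_nat[of p] by (cases "p = 2") auto
  have L2: "Legendre 2 p = -1" using Legendre_2_eq assms(1) odd_p p8 by (simp add: cong_def)
  have double: "norm_form p (2 * of_nat (2 * k)) \<longleftrightarrow> norm_form p (of_nat k)" for k
    using norm_form_mult_square_iff[of 2 p "of_nat k"] by (simp add: mult.commute)
  show ?thesis
  proof
    assume ?L
    obtain b k where k: "b \<in> {0, 1::nat}" "n = p ^ b * k" "\<not> p dvd k" "squarefree k"
      using squarefree_prime_split[OF assms(3,1)] by metis
    obtain c m where m: "c \<in> {0, 1::nat}" "k = 2 ^ c * m" "odd m" "squarefree m"
      using squarefree_prime_split[OF k(4) two_is_prime_nat] by metis
    have pm: "\<not> p dvd m" using k(3) m(2) by auto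
    \<comment> \<open>Serves both parities of \<open>n\<close>: the symbol of \<open>m\<close>
      refutes the odd case, the list is the answer in the even one.\<close>
    have residues: "Legendre m p = 1 \<and> (\<exists>qs. (\<forall>q\<in>set qs. prime q \<and> odd q \<and> Legendre (int q) p = 1) \<and> m = prod_list qs)"
      if qr: "\<And>q. prime q \<Longrightarrow> odd q \<Longrightarrow> q dvd m \<Longrightarrow> QuadRes q (- int p)"
    proof -
      have "odd q \<and> Legendre (int q) p = 1" if "prime q" "q dvd m" for q
      proof -
        have "odd q" "p \<noteq> q" using that m(3) pm by (auto intro: dvd_trans)
        then show ?thesis
          using QuadRes_minus_iff_of_mod_4_eq_3[OF assms(1) m4] qr that by blast
      qed
      then have "m \<noteq> 0 \<and> (\<forall>q. prime q \<longrightarrow> q dvd m \<longrightarrow> odd q \<and> Legendre (int q) p = 1)"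
        using odd_pos[OF m(3)] by auto
      then have "\<exists>qs. (\<forall>q\<in>set qs. prime q \<and> odd q \<and> Legendre (int q) p = 1) \<and> m = prod_list qs"
        unfolding ex_prime_list_iff .
      then obtain qs where "\<forall>q\<in>set qs. prime q \<and> odd q \<and> Legendre (int q) p = 1" "m = prod_list qs"
        by blast
      then show ?thesis using Legendre_prod_list_eq_1[OF assms(1) p2, of qs] by metis
    qed
    show ?R
    proof (cases "c = 0")
      case True
      have n2: "2 * n = p ^ b * (2 * m)" using True k m by simp
      have sq: "squarefree (2 * m)"
        using m(3,4) by (intro squarefree_mult_coprime) (auto simp: squarefree_prime)
      have np: "\<not> p dvd 2 * m" using pm assms(1) p2 by (auto simp: prime_dvd_mult_iff dest: dvd_imp_le)
      have "norm_form p (of_nat (p ^ b * (2 * m)))" using \<open>?L\<close> n2 by (metis of_nat_mult of_nat_numeral)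
      then have *: "\<And>q. prime q \<Longrightarrow> odd q \<Longrightarrow> q dvd 2 * m \<Longrightarrow> QuadRes q (- int p)"
        and **: "QuadRes p (int (2 * m))"
        using norm_form_prime_iff[OF assms(1) sq np] by blast+
      \<comment> \<open>an odd \<open>n\<close> is impossible: all its prime factors are residues, but 2 is not\<close>
      have "Legendre (int (2 * m)) p = 1"
        unfolding Legendre_eq_1_iff of_nat_dvd_iff using ** np by blast
      then have "Legendre 2 p * Legendre m p = 1" using Legendre_mult[OF assms(1) p2] by simp
      then have False using residues * L2 by auto
      then show ?thesis ..
    next
      case False
      then have n: "n = 2 * (p ^ b * m)" using k m by simp
      then have "norm_form p (of_nat (p ^ b * m))" using \<open>?L\<close> double by blast
      then obtain qs where "\<forall>q\<in>set qs. prime q \<and> odd q \<and> Legendre (int q) p = 1" "m = prod_list qs"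
        using norm_form_prime_iff[OF assms(1) m(4) pm] residues by blast
      then show ?thesis using n k(1) by (intro bexI[of _ b] exI[of _ qs]) auto
    qed
  next
    assume ?R
    then obtain b qs where b: "b \<in> {0, 1::nat}" and qs: "\<forall>q\<in>set qs. prime q \<and> odd q \<and> Legendre (int q) p = 1"
      and n: "n = 2 * p ^ b * prod_list qs" by blast
    define m where "m = prod_list qs"
    have "m \<noteq> 0 \<and> (\<forall>q. prime q \<longrightarrow> q dvd m \<longrightarrow> odd q \<and> Legendre (int q) p = 1)"
      using qs m_def by (subst ex_prime_list_iff[symmetric]) blast
    then have mq: "Legendre (int q) p = 1" if "prime q" "q dvd m" for q
      using that by blast+
    have "Legendre m p = 1"
      using Legendre_prod_list_eq_1[OF assms(1) p2, of qs] qs m_def by blast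
    then have k: "\<not> p dvd m" "QuadRes p (int m)"
      by (auto simp: Legendre_eq_1_iff)
    have sq: "squarefree m"
      using assms(3) unfolding n m_def[symmetric] by (rule squarefree_mono[rotated]) simp
    have "QuadRes q (- int p)" if q: "prime q" "odd q" "q dvd m" for q
    proof -
      have "p \<noteq> q" using q(3) k(1) by auto
      then show ?thesis using QuadRes_minus_iff_of_mod_4_eq_3[OF assms(1) m4] q mq by blast
    qed
    then have "norm_form p (of_nat (p ^ b * m))"
      using norm_form_prime_iff[OF assms(1) sq k(1)] k(2) by blast
    then have "norm_form p (2 * of_nat (2 * (p ^ b * m)))" using double by blast
    then show ?L by (simp add: n m_def mult_ac)
  qed
qed

section \<open>Sums of squares and square-free parts\<close>

text \<open>Fermat's two-square theorem over the rationals, read off from the criterion for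
  \<open>d = 1\<close> with the list \<open>[p]\<close>; it supplies the fixed vector
  \<open>(x, y, 0)\<close>.\<close>

lemma prime_sum_two_squares:
  fixes p :: nat
  assumes "prime p" "[p = 1] (mod 4)"
  obtains x y :: real where "x \<in> \<rat>" "y \<in> \<rat>" "real p = x\<^sup>2 + y\<^sup>2"
proof -
  have "p = 2 ^ 0 * prod_list [p]" "odd p"
    using assms(2) cong_dvd_modulus_nat[of p 1 4 2] by (simp_all add: cong_def odd_iff_mod_2_eq_one)
  then have "norm_form 1 (of_nat p)"
    unfolding norm_form_1_iff[OF squarefree_prime[OF assms(1)]] using assms
    by (intro bexI[of _ 0] exI[of _ "[p]"]) auto
  then show ?thesis using that unfolding norm_form_def by auto
qed

text \<open>Likewise from the criterion for \<open>d = 2\<close>; it supplies the fixed vector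
  \<open>(x, y, y)\<close>.\<close>

lemma prime_sum_square_double_square:
  fixes p :: nat
  assumes "prime p" "[p = 3] (mod 8)"
  obtains x y :: real where "x \<in> \<rat>" "y \<in> \<rat>" "real p = x\<^sup>2 + 2 * y\<^sup>2"
proof -
  have "p = 2 ^ 0 * prod_list [p]" "odd p"
    using assms(2) cong_dvd_modulus_nat[of p 3 8 2] by (simp_all add: cong_def odd_iff_mod_2_eq_one)
  then have "norm_form 2 (of_nat p)"
    unfolding norm_form_2_iff[OF squarefree_prime[OF assms(1)]] using assms
    by (intro bexI[of _ 0] exI[of _ "[p]"]) auto
  then show ?thesis using that unfolding norm_form_def by auto
qed

text \<open>The minimum exists because \<open>a / b\<close> is \<open>a * b\<close> times the square
  of \<open>1 / b\<close>. A square divisor \<open>k^2\<close> could be moved into the rational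
  square, so minimality makes the value squarefree.\<close>

lemma sqfree_part_decompose:
  assumes "X \<in> \<rat>" "X > 0"
  obtains r where "r \<in> \<rat>" "r \<noteq> 0" "X = real (sqfree_part X) * r\<^sup>2" "squarefree (sqfree_part X)"
proof -
  define P where "P = (\<lambda>N :: nat. N > 0 \<and> (\<exists>r\<in>\<rat>. X / real N = r\<^sup>2))"
  obtain a b where ab: "b > 0" "X = of_int a / of_int b" using Rats_cases'[OF assms(1)] by metis
  have a: "a > 0" using assms(2) ab by (simp add: zero_less_divide_iff)
  have "P (nat (a * b))" unfolding P_def
  proof (intro conjI bexI[of _ "1 / of_int b"])
    show "X / real (nat (a * b)) = (1 / of_int b)\<^sup>2"
      using a ab by (simp add: power2_eq_square field_simps)
  qed (use a ab in auto)
  then have "P (sqfree_part X)" unfolding sqfree_part_def P_def[symmetric] by (rule LeastI)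
  then obtain r where N: "sqfree_part X > 0" and r: "r \<in> \<rat>" "X / real (sqfree_part X) = r\<^sup>2"
    unfolding P_def by blast
  have X: "X = real (sqfree_part X) * r\<^sup>2" using N r(2) by (simp add: field_simps)
  have "squarefree (sqfree_part X)"
  proof (rule squarefreeI)
    fix k assume "k\<^sup>2 dvd sqfree_part X"
    then obtain m where m: "sqfree_part X = k\<^sup>2 * m" by blast
    then have pos: "k > 0" "m > 0" using N by (auto intro!: gr0I)
    have "X / real m = (k * r)\<^sup>2" using X pos unfolding m by (simp add: power_mult_distrib)
    then have "P m" unfolding P_def using pos r(1) by auto
    then have "sqfree_part X \<le> m" unfolding sqfree_part_def P_def[symmetric] by (rule Least_le)
    then have "k\<^sup>2 \<le> 1" using pos unfolding m by simp
    then show "k dvd 1" using pos power2_nat_le_imp_le[of k 1] by simp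
  qed
  then show ?thesis using that r X assms(2) by (metis less_irrefl mult_zero_right power_zero_numeral)
qed

section \<open>Orthogonal rational vectors\<close>

definition Q3 :: "(real ^ 3) set" where
  "Q3 = {v. \<forall>i. v $ i \<in> \<rat>}"

lemma Z3_subset_Q3: "Z3 \<subseteq> Q3"
  unfolding Z3_def Q3_def using Ints_subset_Rats by auto

lemma Q3_add: "u \<in> Q3 \<Longrightarrow> v \<in> Q3 \<Longrightarrow> u + v \<in> Q3"
  and Q3_diff: "u \<in> Q3 \<Longrightarrow> v \<in> Q3 \<Longrightarrow> u - v \<in> Q3"
  and Q3_scale: "k \<in> \<rat> \<Longrightarrow> v \<in> Q3 \<Longrightarrow> k *\<^sub>R v \<in> Q3"
  by (auto simp: Q3_def)

lemma inner_Q3: "u \<in> Q3 \<Longrightarrow> v \<in> Q3 \<Longrightarrow> inner u v \<in> \<rat>"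
  by (simp add: Q3_def inner_vec_def sum_3)

lemma cross3_Q3: "u \<in> Q3 \<Longrightarrow> v \<in> Q3 \<Longrightarrow> cross3 u v \<in> Q3"
  by (simp add: Q3_def cross3_def forall_3)

lemma vector_Q3: "x \<in> \<rat> \<Longrightarrow> y \<in> \<rat> \<Longrightarrow> z \<in> \<rat> \<Longrightarrow> vector [x, y, z] \<in> Q3"
  by (simp add: Q3_def forall_3)

lemma inner_vector_3: "inner (vector [x, y, z]) (v :: real ^ 3) = x * v $ 1 + y * v $ 2 + z * v $ 3"
  by (simp add: inner_vec_def sum_3)

lemma Q3_clear_denominators:
  assumes "v \<in> Q3"
  obtains k :: real where "k > 0" "k *\<^sub>R v \<in> Z3"
proof -
  have "\<exists>k::int. k > 0 \<and> of_int k * v $ i \<in> \<int>" for i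
  proof -
    have "v $ i \<in> \<rat>" using assms by (simp add: Q3_def)
    then obtain a b where "b > 0" "v $ i = of_int a / of_int b" by (metis Rats_cases')
    then show ?thesis by (intro exI[of _ b]) simp
  qed
  then obtain k :: "3 \<Rightarrow> int" where k: "\<And>i. k i > 0" "\<And>i. of_int (k i) * v $ i \<in> \<int>" by metis
  define K where "K = k 1 * k 2 * k 3"
  have "of_int K * v $ i \<in> \<int>" for i
  proof -
    have "of_int K * v $ 1 = of_int (k 2 * k 3) * (of_int (k 1) * v $ 1)"
      "of_int K * v $ 2 = of_int (k 1 * k 3) * (of_int (k 2) * v $ 2)"
      "of_int K * v $ 3 = of_int (k 1 * k 2) * (of_int (k 3) * v $ 3)"
      by (simp_all add: K_def)
    then have "\<forall>i. of_int K * v $ i \<in> \<int>" unfolding forall_3 using k(2) Ints_mult Ints_of_int by metis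
    then show ?thesis by blast
  qed
  then have "of_int K *\<^sub>R v \<in> Z3" unfolding Z3_def by simp
  moreover have "of_int K > (0 :: real)" using k(1) by (simp add: K_def)
  ultimately show ?thesis using that by blast
qed

text \<open>The isometry is the reflection along \<open>u - v\<close>, which maps \<open>u\<close> to \<open>v\<close>.\<close>

lemma rational_isometry:
  assumes "u \<in> Q3" "v \<in> Q3" "w \<in> Q3" "inner u u = inner v v"
  obtains w' where "w' \<in> Q3" "inner w' w' = inner w w" "inner v w' = inner u w"
proof (cases "u = v")
  case False
  define z where "z = u - v"
  define r where "r = 2 * inner w z / inner z z"
  \<comment> \<open>Equality of the lengths of \<open>u\<close> and \<open>v\<close> enters here; it
    lets the reflection turn products with \<open>u\<close> into products with
    \<open>v\<close>.\<close>
  have zz: "inner z z = - 2 * inner v z"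
    unfolding z_def using assms(4) by (simp add: inner_diff_left inner_diff_right inner_commute)
  have "inner z z \<noteq> 0" using False by (simp add: z_def)
  then have r: "r * inner z z = 2 * inner w z" by (simp add: r_def)
  have rQ: "r \<in> \<rat>" and zQ: "z \<in> Q3"
    using assms by (simp_all add: r_def z_def inner_Q3 Q3_diff)
  show ?thesis
  proof (rule that[of "w - r *\<^sub>R z"])
    show "w - r *\<^sub>R z \<in> Q3" using assms rQ zQ by (simp add: Q3_diff Q3_scale)
    have "inner (w - r *\<^sub>R z) (w - r *\<^sub>R z) = inner w w + r * (r * inner z z - 2 * inner w z)"
      by (simp add: inner_diff_left inner_diff_right inner_commute algebra_simps)
    then show "inner (w - r *\<^sub>R z) (w - r *\<^sub>R z) = inner w w" using r by simp
    have "inner v (w - r *\<^sub>R z) = inner v w - r * inner v z" by (simp add: inner_diff_right)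
    also have "r * inner v z = - inner w z" using r zz by simp
    finally show "inner v (w - r *\<^sub>R z) = inner u w"
      by (simp add: z_def inner_diff_right inner_commute)
  qed
qed (use assms that in blast)

text \<open>Whether an orthogonal pair exists depends only on the two squared lengths: an isometry
  taking \<open>c\<close> to \<open>c\<^sub>0\<close> moves \<open>a\<close> to \<open>a'\<close>,
  and one taking \<open>a'\<close> to \<open>a\<close> moves \<open>c\<^sub>0\<close> to
  \<open>c\<close>.\<close>

lemma orthogonal_transfer:
  assumes "c\<^sub>0 \<in> Q3" "a \<in> Q3"
  shows "(\<exists>c\<in>Q3. inner a c = 0 \<and> inner c c = inner c\<^sub>0 c\<^sub>0) \<longleftrightarrow>
    (\<exists>a'\<in>Q3. inner c\<^sub>0 a' = 0 \<and> inner a' a' = inner a a)"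
proof
  assume "\<exists>c\<in>Q3. inner a c = 0 \<and> inner c c = inner c\<^sub>0 c\<^sub>0"
  then show "\<exists>a'\<in>Q3. inner c\<^sub>0 a' = 0 \<and> inner a' a' = inner a a"
    using rational_isometry[of _ c\<^sub>0 a] assms by (metis inner_commute)
next
  assume "\<exists>a'\<in>Q3. inner c\<^sub>0 a' = 0 \<and> inner a' a' = inner a a"
  then show "\<exists>c\<in>Q3. inner a c = 0 \<and> inner c c = inner c\<^sub>0 c\<^sub>0"
    using rational_isometry[of _ a c\<^sub>0] assms by (metis inner_commute)
qed

text \<open>The plane orthogonal to \<open>(x, y, 0)\<close> has the orthogonal basis
  \<open>(0, 0, 1)\<close>, \<open>(- y, x, 0)\<close> with squared lengths 1 and \<open>t\<close>,
  so the squared lengths of its rational vectors are the values of the norm form.\<close>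

lemma ex_orthogonal_sum_two_squares:
  fixes t :: nat
  assumes "a \<in> Q3" "t > 0" "x \<in> \<rat>" "y \<in> \<rat>" "real t = x\<^sup>2 + y\<^sup>2"
  shows "(\<exists>c\<in>Q3. inner a c = 0 \<and> inner c c = t) \<longleftrightarrow> norm_form t (inner a a)"
proof -
  define c :: "real ^ 3" where "c = vector [x, y, 0]"
  have cQ: "c \<in> Q3" and cc: "inner c c = t"
    using assms by (simp_all add: c_def vector_Q3 inner_vector_3 power2_eq_square)
  have "(\<exists>c\<in>Q3. inner a c = 0 \<and> inner c c = t) \<longleftrightarrow>
    (\<exists>a'\<in>Q3. inner c a' = 0 \<and> inner a' a' = inner a a)"
    using orthogonal_transfer[OF cQ assms(1)] unfolding cc .
  also have "\<dots> \<longleftrightarrow> norm_form t (inner a a)"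
  proof
    assume "\<exists>a'\<in>Q3. inner c a' = 0 \<and> inner a' a' = inner a a"
    then obtain a' where a': "a' \<in> Q3" "inner c a' = 0" "inner a' a' = inner a a" by blast
    have Q: "a' $ 1 \<in> \<rat>" "a' $ 2 \<in> \<rat>" "a' $ 3 \<in> \<rat>" using a'(1) by (auto simp: Q3_def)
    have orth: "x * a' $ 1 + y * a' $ 2 = 0" using a'(2) by (simp add: c_def inner_vector_3)
    show "norm_form t (inner a a)"
    proof (rule norm_formI)
      \<comment> \<open>The coordinates of \<open>a'\<close> in that basis.\<close>
      show "a' $ 3 \<in> \<rat>" "(a' $ 2 * x - a' $ 1 * y) / t \<in> \<rat>" using Q assms by auto
      have "(a' $ 2 * x - a' $ 1 * y)\<^sup>2 + (x * a' $ 1 + y * a' $ 2)\<^sup>2 = t * ((a' $ 1)\<^sup>2 + (a' $ 2)\<^sup>2)"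
        unfolding assms(5) by (simp add: power2_eq_square algebra_simps)
      then have "(a' $ 2 * x - a' $ 1 * y)\<^sup>2 = t * ((a' $ 1)\<^sup>2 + (a' $ 2)\<^sup>2)"
        using orth by simp
      then have "t * ((a' $ 2 * x - a' $ 1 * y) / t)\<^sup>2 = (a' $ 1)\<^sup>2 + (a' $ 2)\<^sup>2"
        using assms(2) by (simp add: power_divide power2_eq_square)
      then show "inner a a = (a' $ 3)\<^sup>2 + t * ((a' $ 2 * x - a' $ 1 * y) / t)\<^sup>2"
        unfolding a'(3)[symmetric] by (simp add: inner_vec_def sum_3 power2_eq_square)
    qed
  next
    assume "norm_form t (inner a a)"
    then obtain u v where uv: "u \<in> \<rat>" "v \<in> \<rat>" "inner a a = u\<^sup>2 + real t * v\<^sup>2"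
      unfolding norm_form_def by blast
    show "\<exists>a'\<in>Q3. inner c a' = 0 \<and> inner a' a' = inner a a"
    proof (intro bexI conjI)
      show "vector [- y * v, x * v, u] \<in> Q3" using uv assms by (intro vector_Q3) auto
      show "inner c (vector [- y * v, x * v, u]) = 0"
        by (simp add: c_def inner_vector_3)
      show "inner (vector [- y * v, x * v, u]) (vector [- y * v, x * v, u] :: real ^ 3) = inner a a"
        unfolding uv(3) assms(5) by (simp add: inner_vector_3 power2_eq_square algebra_simps)
    qed
  qed
  finally show ?thesis .
qed

text \<open>The plane orthogonal to \<open>(x, y, y)\<close> has the orthogonal basis
  \<open>(0, 1, -1)\<close>, \<open>(- 2 y, x, x)\<close> with squared lengths 2 and
  \<open>2 t\<close>. Doubling a squared length \<open>2 i^2 + 2 t j^2\<close> gives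
  \<open>(2 i)^2 + t (2 j)^2\<close>, which explains the factor 2.\<close>

lemma ex_orthogonal_square_plus_double_square:
  fixes t :: nat
  assumes "a \<in> Q3" "t > 0" "x \<in> \<rat>" "y \<in> \<rat>" "real t = x\<^sup>2 + 2 * y\<^sup>2"
  shows "(\<exists>c\<in>Q3. inner a c = 0 \<and> inner c c = t) \<longleftrightarrow> norm_form t (2 * inner a a)"
proof -
  define c :: "real ^ 3" where "c = vector [x, y, y]"
  have cQ: "c \<in> Q3" and cc: "inner c c = t"
    using assms by (simp_all add: c_def vector_Q3 inner_vector_3 power2_eq_square)
  have "(\<exists>c\<in>Q3. inner a c = 0 \<and> inner c c = t) \<longleftrightarrow>
    (\<exists>a'\<in>Q3. inner c a' = 0 \<and> inner a' a' = inner a a)"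
    using orthogonal_transfer[OF cQ assms(1)] unfolding cc .
  also have "\<dots> \<longleftrightarrow> norm_form t (2 * inner a a)"
  proof
    assume "\<exists>a'\<in>Q3. inner c a' = 0 \<and> inner a' a' = inner a a"
    then obtain a' where a': "a' \<in> Q3" "inner c a' = 0" "inner a' a' = inner a a" by blast
    define u v w where "u = a' $ 1" and "v = a' $ 2" and "w = a' $ 3"
    have Q: "u \<in> \<rat>" "v \<in> \<rat>" "w \<in> \<rat>" using a'(1) by (auto simp: Q3_def u_def v_def w_def)
    have orth: "x * u + y * v + y * w = 0"
      using a'(2) by (simp add: c_def inner_vector_3 u_def v_def w_def)
    show "norm_form t (2 * inner a a)"
    proof (rule norm_formI)
      \<comment> \<open>Twice the coordinates of \<open>a'\<close> in that basis.\<close>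
      show "v - w \<in> \<rat>" "((v + w) * x - 2 * u * y) / t \<in> \<rat>" using Q assms by auto
      have "((v + w) * x - 2 * u * y)\<^sup>2 + 2 * (x * u + y * v + y * w)\<^sup>2 = t * (2 * u\<^sup>2 + (v + w)\<^sup>2)"
        unfolding assms(5) by (simp add: power2_eq_square algebra_simps)
      then have "((v + w) * x - 2 * u * y)\<^sup>2 = t * (2 * u\<^sup>2 + (v + w)\<^sup>2)"
        using orth by simp
      then have "t * (((v + w) * x - 2 * u * y) / t)\<^sup>2 = 2 * u\<^sup>2 + (v + w)\<^sup>2"
        using assms(2) by (simp add: power_divide power2_eq_square)
      then show "2 * inner a a = (v - w)\<^sup>2 + t * (((v + w) * x - 2 * u * y) / t)\<^sup>2"
        unfolding a'(3)[symmetric]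
        by (simp add: inner_vec_def sum_3 power2_eq_square u_def v_def w_def algebra_simps)
    qed
  next
    assume "norm_form t (2 * inner a a)"
    then obtain u v where uv: "u \<in> \<rat>" "v \<in> \<rat>" "2 * inner a a = u\<^sup>2 + real t * v\<^sup>2"
      unfolding norm_form_def by blast
    \<comment> \<open>The vector with coordinates \<open>u / 2\<close> and \<open>v / 2\<close> in
      that basis.\<close>
    define a' :: "real ^ 3" where "a' = vector [- y * v, (x * v + u) / 2, (x * v - u) / 2]"
    show "\<exists>a'\<in>Q3. inner c a' = 0 \<and> inner a' a' = inner a a"
    proof (intro bexI conjI)
      show "a' \<in> Q3" unfolding a'_def using uv assms by (intro vector_Q3) auto
      show "inner c a' = 0"
        by (simp add: c_def a'_def inner_vector_3 field_simps)
      have "2 * inner a' a' = 2 * inner a a"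
        unfolding uv(3) assms(5)
        by (simp add: a'_def inner_vector_3 power2_eq_square field_simps)
      then show "inner a' a' = inner a a" by simp
    qed
  qed
  finally show ?thesis .
qed

section \<open>Angles and the passage to orthogonal vectors\<close>

lemma cos_vec_angle: "cos (vec_angle a b) = inner a b / (norm a * norm b)"
proof -
  \<comment> \<open>For a zero vector the quotient is 0 by the convention on division, so the bound
    persists.\<close>
  have "\<bar>inner a b / (norm a * norm b)\<bar> \<le> 1"
    using Cauchy_Schwarz_ineq2[of a b]
    by (cases "norm a * norm b = 0") (auto simp: abs_mult divide_le_eq)
  then show ?thesis unfolding vec_angle_def by (rule cos_arccos_abs)
qed

lemma vec_angle_scale: "k > 0 \<Longrightarrow> vec_angle a (k *\<^sub>R b) = vec_angle a b"
  by (simp add: vec_angle_def)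

lemma Theta3_iff_ex_orthogonal:
  assumes "a \<in> Z3 - {0}" "0 < \<theta>" "\<theta> < pi" "\<theta> \<noteq> pi / 2"
    and "(tan \<theta>)\<^sup>2 = t * r\<^sup>2" "r \<in> \<rat>"
  shows "\<theta> \<in> Theta3 a \<longleftrightarrow> (\<exists>c\<in>Q3. inner a c = 0 \<and> inner c c = t)"
proof -
  have aQ: "a \<in> Q3" and a0: "a \<noteq> 0" using assms(1) Z3_subset_Q3 by auto
  have sin0: "sin \<theta> > 0" using assms by (simp add: sin_gt_zero)
  have cos0: "cos \<theta> \<noteq> 0"
    using assms cos_inj_pi[of \<theta> "pi / 2"] by auto
  have cos_tan: "(cos \<theta>)\<^sup>2 * (1 + t * r\<^sup>2) = 1"
    unfolding assms(5)[symmetric] tan_def using cos0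
    by (simp add: power_divide distrib_left)
  have tan0: "(tan \<theta>)\<^sup>2 \<noteq> 0" using sin0 cos0 by (simp add: tan_def)
  then have r0: "r \<noteq> 0" using assms(5) by auto
  show ?thesis
  proof
    assume "\<theta> \<in> Theta3 a"
    then obtain b where b: "b \<in> Z3" "b \<noteq> 0" "\<theta> = vec_angle a b" unfolding Theta3_def by blast
    have bQ: "b \<in> Q3" using b(1) Z3_subset_Q3 by auto
    have cos: "cos \<theta> * (norm a * norm b) = inner a b"
      using cos_vec_angle a0 b(2,3) by simp
    have ab0: "inner a b \<noteq> 0" using cos cos0 a0 b(2) by (metis mult_eq_0_iff norm_eq_zero)
    \<comment> \<open>\<open>cross3 a b\<close> has squared length
      \<open>(inner a b)^2 * tan^2 = t * (inner a b * r)^2\<close>, which dictates the factor; the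
      denominator is nonzero because \<open>cos \<theta>\<close> and \<open>r\<close> are.\<close>
    define c where "c = (1 / (inner a b * r)) *\<^sub>R cross3 a b"
    have "(inner a b)\<^sup>2 * (1 + t * r\<^sup>2) = (cos \<theta>)\<^sup>2 * (1 + t * r\<^sup>2) * (norm a * norm b)\<^sup>2"
      unfolding cos[symmetric] by (simp add: power_mult_distrib)
    then have "(inner a b)\<^sup>2 * (1 + t * r\<^sup>2) = (norm a * norm b)\<^sup>2"
      unfolding cos_tan by simp
    then have "(norm (cross3 a b))\<^sup>2 = t * (inner a b * r)\<^sup>2"
      using norm_cross_dot[of a b] by (simp add: algebra_simps)
    then have "inner (cross3 a b) (cross3 a b) = t * (inner a b * r)\<^sup>2"
      unfolding power2_norm_eq_inner .
    then have "inner c c = t" unfolding c_def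
      using ab0 r0 by (simp add: power2_eq_square)
    moreover have "c \<in> Q3" unfolding c_def
      using aQ bQ assms(6) by (intro Q3_scale cross3_Q3 Rats_divide Rats_mult inner_Q3) auto
    moreover have "inner a c = 0" unfolding c_def by (simp add: dot_cross_self)
    ultimately show "\<exists>c\<in>Q3. inner a c = 0 \<and> inner c c = t" by blast
  next
    assume "\<exists>c\<in>Q3. inner a c = 0 \<and> inner c c = t"
    then obtain c where c: "c \<in> Q3" "inner a c = 0" "inner c c = t" by blast
    \<comment> \<open>\<open>a\<close> and \<open>r *\<^sub>R d\<close> are the legs of a right
      triangle with ratio \<open>\<bar>tan \<theta>\<bar>\<close>, so their sum makes the angle
      \<open>\<theta>\<close> or \<open>pi - \<theta>\<close> with \<open>a\<close>.\<close>
    define d where "d = cross3 a c"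
    have dd: "inner d d = inner a a * t"
      using norm_cross_dot[of a c] c unfolding d_def by (simp add: power_mult_distrib power2_norm_eq_inner)
    have ad: "inner a d = 0" unfolding d_def by (simp add: dot_cross_self)
    \<comment> \<open>The sign reverses the vector when \<open>\<theta>\<close> is obtuse, since
      squares determine only \<open>\<bar>cos \<theta>\<bar>\<close>.\<close>
    define b where "b = sgn (cos \<theta>) *\<^sub>R (a + r *\<^sub>R d)"
    have bQ: "b \<in> Q3" unfolding b_def d_def
      using aQ c(1) assms(6) by (intro Q3_scale Q3_add cross3_Q3) (auto simp: sgn_if)
    have ab: "inner a b = sgn (cos \<theta>) * inner a a"
      unfolding b_def using ad by (simp add: inner_add_right)
    have b0: "b \<noteq> 0" using ab cos0 a0 by (auto simp: sgn_zero_iff)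
    have "inner b b = inner a a * (1 + t * r\<^sup>2)"
      unfolding b_def using ad dd cos0
      by (simp add: inner_add_right inner_add_left inner_commute sgn_if power2_eq_square algebra_simps)
    then have "(\<bar>cos \<theta>\<bar> * norm b)\<^sup>2 = (norm a)\<^sup>2"
      using cos_tan by (simp add: power_mult_distrib power2_norm_eq_inner mult.left_commute[of "(cos \<theta>)\<^sup>2"])
    then have "\<bar>cos \<theta>\<bar> * norm b = norm a" by (simp add: power2_eq_iff_nonneg)
    then have "cos \<theta> * (norm a * norm b) = inner a b"
      unfolding ab by (metis abs_sgn mult_sgn_abs mult.assoc mult.commute power2_norm_eq_inner power2_eq_square)
    then have "cos (vec_angle a b) = cos \<theta>"
      unfolding cos_vec_angle using a0 b0 by (simp add: field_simps)
    then have "arccos (cos (vec_angle a b)) = \<theta>" using assms by (simp add: arccos_cos)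
    then have ang: "vec_angle a b = \<theta>" by (simp add: cos_vec_angle flip: vec_angle_def)
    obtain k where k: "k > 0" "k *\<^sub>R b \<in> Z3" using Q3_clear_denominators[OF bQ] by blast
    then have "k *\<^sub>R b \<in> Z3 - {0}" "\<theta> = vec_angle a (k *\<^sub>R b)"
      using b0 vec_angle_scale ang by auto
    then show "\<theta> \<in> Theta3 a" unfolding Theta3_def by blast
  qed
qed

theorem theorem3p7:
  fixes a :: "real ^ 3" and \<theta> :: real and N :: nat
  assumes "a \<in> Z3 - {0}"
    and "0 < \<theta>" and "\<theta> < pi" and "\<theta> \<noteq> pi / 2"
    and "N = sqfree_part ((norm a)\<^sup>2)"
  shows
    "((\<exists>r\<in>\<rat>. (tan \<theta>)\<^sup>2 = r\<^sup>2) \<longrightarrow>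
        (\<theta> \<in> Theta3 a \<longleftrightarrow>
          (\<exists>b\<in>{0, 1::nat}. \<exists>qs :: nat list.
             (\<forall>q\<in>set qs. prime q \<and> odd q \<and> [q = 1] (mod 4)) \<and>
             N = 2 ^ b * prod_list qs)))
     \<and>
     ((tan \<theta>)\<^sup>2 \<in> \<rat> \<and> sqfree_part ((tan \<theta>)\<^sup>2) = 2 \<longrightarrow>
        (\<theta> \<in> Theta3 a \<longleftrightarrow>
          (\<exists>b\<in>{0, 1::nat}. \<exists>qs :: nat list.
             (\<forall>q\<in>set qs. prime q \<and> odd q \<and> ([q = 1] (mod 8) \<or> [q = 3] (mod 8))) \<and>
             N = 2 ^ b * prod_list qs)))
     \<and>
     (\<forall>p :: nat. prime p \<and> odd p \<and> (tan \<theta>)\<^sup>2 \<in> \<rat> \<and> sqfree_part ((tan \<theta>)\<^sup>2) = p \<longrightarrow>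
        ([p = 3] (mod 8) \<longrightarrow>
          (\<theta> \<in> Theta3 a \<longleftrightarrow>
            (\<exists>b\<in>{0, 1::nat}. \<exists>qs :: nat list.
               (\<forall>q\<in>set qs. prime q \<and> odd q \<and> Legendre (int q) (int p) = 1) \<and>
               N = 2 * p ^ b * prod_list qs)))
        \<and>
        ([p = 1] (mod 8) \<longrightarrow>
          (\<theta> \<in> Theta3 a \<longleftrightarrow>
            (\<exists>b\<in>{0, 1::nat}. \<exists>b'\<in>{0, 1::nat}. \<exists>qs :: nat list.
               (\<forall>q\<in>set qs. prime q \<and> odd q \<and>
                  Legendre (int q) (int p) = (- 1) ^ ((q - 1) div 2)) \<and>
               even ((prod_list qs - 1) div 2) \<and>
               N = 2 ^ b * p ^ b' * prod_list qs)))
        \<and>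
        ([p = 5] (mod 8) \<longrightarrow>
          (\<theta> \<in> Theta3 a \<longleftrightarrow>
            (\<exists>b\<in>{0, 1::nat}. \<exists>qs :: nat list.
               (\<forall>q\<in>set qs. prime q \<and> odd q \<and>
                  Legendre (int q) (int p) = (- 1) ^ ((q - 1) div 2)) \<and>
               even ((prod_list qs - 1) div 2) \<and>
               N = p ^ b * prod_list qs) \<or>
            (\<exists>b\<in>{0, 1::nat}. \<exists>qs :: nat list.
               (\<forall>q\<in>set qs. prime q \<and> odd q \<and>
                  Legendre (int q) (int p) = (- 1) ^ ((q - 1) div 2)) \<and>
               odd ((prod_list qs - 1) div 2) \<and>
               N = 2 * p ^ b * prod_list qs))))"
proof -
  have aQ: "a \<in> Q3" and a0: "a \<noteq> 0" using assms(1) Z3_subset_Q3 by auto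
  have "(norm a)\<^sup>2 \<in> \<rat>" "(norm a)\<^sup>2 > 0"
    using aQ a0 by (simp_all add: power2_norm_eq_inner inner_Q3)
  then obtain s where s: "s \<in> \<rat>" "s \<noteq> 0" "(norm a)\<^sup>2 = real N * s\<^sup>2" "squarefree N"
    unfolding assms(5) by (rule sqfree_part_decompose)
  \<comment> \<open>The squared length of \<open>a\<close> and \<open>N\<close> differ by a rational
    square factor, which the norm form ignores; \<open>k\<close> will be 1 or 2.\<close>
  have norm_iff: "norm_form t (k * inner a a) \<longleftrightarrow> norm_form t (k * real N)" for t k
    using norm_form_mult_square_iff[OF s(1,2), of t "k * real N"] s(3)
    by (simp add: power2_norm_eq_inner mult.assoc)
  have "tan \<theta> \<noteq> 0"
    using assms(2-4) sin_gt_zero[of \<theta>] cos_inj_pi[of \<theta> "pi / 2"] by (auto simp: tan_def)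
  then have tan_pos: "(tan \<theta>)\<^sup>2 > 0" by simp
  \<comment> \<open>Used for \<open>t = 1 = 1^2 + 0^2\<close>, for \<open>t = 2 = 1^2 + 1^2\<close>
    and for primes congruent to 1 modulo 4.\<close>
  have sum_squares: "\<theta> \<in> Theta3 a \<longleftrightarrow> norm_form t N"
    if "(tan \<theta>)\<^sup>2 = real t * r\<^sup>2" "r \<in> \<rat>" "t > 0" "x \<in> \<rat>" "y \<in> \<rat>" "real t = x\<^sup>2 + y\<^sup>2"
    for t :: nat and r x y
    using Theta3_iff_ex_orthogonal[OF assms(1-4) that(1,2)]
      ex_orthogonal_sum_two_squares[OF aQ that(3-6)] norm_iff[of t 1] by simp
  \<comment> \<open>Used for primes congruent to 3 modulo 8, which are not sums of two
    squares.\<close>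
  have sum_double: "\<theta> \<in> Theta3 a \<longleftrightarrow> norm_form t (2 * N)"
    if "(tan \<theta>)\<^sup>2 = real t * r\<^sup>2" "r \<in> \<rat>" "t > 0" "x \<in> \<rat>" "y \<in> \<rat>" "real t = x\<^sup>2 + 2 * y\<^sup>2"
    for t :: nat and r x y
    using Theta3_iff_ex_orthogonal[OF assms(1-4) that(1,2)]
      ex_orthogonal_square_plus_double_square[OF aQ that(3-6)] norm_iff[of t 2] by simp
  show ?thesis
  proof (intro conjI impI allI)
    assume "\<exists>r\<in>\<rat>. (tan \<theta>)\<^sup>2 = r\<^sup>2"
    then obtain r where "r \<in> \<rat>" "(tan \<theta>)\<^sup>2 = real 1 * r\<^sup>2" by auto
    then have "\<theta> \<in> Theta3 a \<longleftrightarrow> norm_form 1 N" using sum_squares[of 1 r 1 0] by simp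
    then show "\<theta> \<in> Theta3 a \<longleftrightarrow>
        (\<exists>b\<in>{0, 1::nat}. \<exists>qs :: nat list.
          (\<forall>q\<in>set qs. prime q \<and> odd q \<and> [q = 1] (mod 4)) \<and> N = 2 ^ b * prod_list qs)"
      unfolding norm_form_1_iff[OF s(4)] .
  next
    assume tan: "(tan \<theta>)\<^sup>2 \<in> \<rat> \<and> sqfree_part ((tan \<theta>)\<^sup>2) = 2"
    then obtain r where "r \<in> \<rat>" "(tan \<theta>)\<^sup>2 = real 2 * r\<^sup>2"
      using sqfree_part_decompose[of "(tan \<theta>)\<^sup>2"] tan_pos by metis
    then have "\<theta> \<in> Theta3 a \<longleftrightarrow> norm_form 2 N" using sum_squares[of 2 r 1 1] by simp
    then show "\<theta> \<in> Theta3 a \<longleftrightarrow>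
        (\<exists>b\<in>{0, 1::nat}. \<exists>qs :: nat list.
          (\<forall>q\<in>set qs. prime q \<and> odd q \<and> ([q = 1] (mod 8) \<or> [q = 3] (mod 8))) \<and>
          N = 2 ^ b * prod_list qs)"
      unfolding norm_form_2_iff[OF s(4)] .
  next
    fix p :: nat
    assume p: "prime p \<and> odd p \<and> (tan \<theta>)\<^sup>2 \<in> \<rat> \<and> sqfree_part ((tan \<theta>)\<^sup>2) = p"
    then obtain r where r: "(tan \<theta>)\<^sup>2 = real p * r\<^sup>2" "r \<in> \<rat>"
      using sqfree_part_decompose[of "(tan \<theta>)\<^sup>2"] tan_pos by metis
    have prime: "prime p" and pos: "p > 0" using p prime_gt_0_nat by auto
    have mod_4: "\<theta> \<in> Theta3 a \<longleftrightarrow> norm_form p N" if "[p = 1] (mod 4)"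
      using prime_sum_two_squares[OF prime that] sum_squares[OF r pos] by metis
    {
      assume mod: "[p = 3] (mod 8)"
      have "\<theta> \<in> Theta3 a \<longleftrightarrow> norm_form p (2 * N)"
        using prime_sum_square_double_square[OF prime mod] sum_double[OF r pos] by metis
      then show "\<theta> \<in> Theta3 a \<longleftrightarrow>
          (\<exists>b\<in>{0, 1::nat}. \<exists>qs :: nat list.
            (\<forall>q\<in>set qs. prime q \<and> odd q \<and> Legendre (int q) (int p) = 1) \<and>
            N = 2 * p ^ b * prod_list qs)"
        using norm_form_double_prime_iff_of_mod_8_eq_3[OF prime mod s(4)] by simp
    next
      assume mod: "[p = 1] (mod 8)"
      then have "[p = 1] (mod 4)" using cong_dvd_modulus_nat[of p 1 8 4] by simp
      from mod_4[OF this] show "\<theta> \<in> Theta3 a \<longleftrightarrow>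
          (\<exists>b\<in>{0, 1::nat}. \<exists>b'\<in>{0, 1::nat}. \<exists>qs :: nat list.
            (\<forall>q\<in>set qs. prime q \<and> odd q \<and>
              Legendre (int q) (int p) = (- 1) ^ ((q - 1) div 2)) \<and>
            even ((prod_list qs - 1) div 2) \<and>
            N = 2 ^ b * p ^ b' * prod_list qs)"
        unfolding norm_form_prime_iff_of_mod_8_eq_1[OF prime mod s(4)] .
    next
      assume mod: "[p = 5] (mod 8)"
      then have "[p = 1] (mod 4)" using cong_dvd_modulus_nat[of p 5 8 4] by (simp add: cong_def)
      from mod_4[OF this] show "\<theta> \<in> Theta3 a \<longleftrightarrow>
          (\<exists>b\<in>{0, 1::nat}. \<exists>qs :: nat list.
            (\<forall>q\<in>set qs. prime q \<and> odd q \<and>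
              Legendre (int q) (int p) = (- 1) ^ ((q - 1) div 2)) \<and>
            even ((prod_list qs - 1) div 2) \<and>
            N = p ^ b * prod_list qs) \<or>
          (\<exists>b\<in>{0, 1::nat}. \<exists>qs :: nat list.
            (\<forall>q\<in>set qs. prime q \<and> odd q \<and>
              Legendre (int q) (int p) = (- 1) ^ ((q - 1) div 2)) \<and>
            odd ((prod_list qs - 1) div 2) \<and>
            N = 2 * p ^ b * prod_list qs)"
        unfolding norm_form_prime_iff_of_mod_8_eq_5[OF prime mod s(4)] .
    }
  qed
qed

end
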